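(* Let $\mathbb V_{\mu,t}:=\mathbb V_{\mu,t}(\theta^*_{\mathrm{DOD}})$ for the choice of DOD weights $\theta^*_{\mathrm{DOD}}\in\Theta(\Phi_{\tilde{\mathbb V}})$ described in the context (DOD bound), let $\hat q_{\mathrm D}=R_\rho(\Phi^{\mathrm D}_{N'}(\theta_{\mathrm{DDNN}})):\mathbb R^{p+q+1}\to\mathbb R^{N'}$ be the realization of some neural network with any weights $\theta_{\mathrm{DDNN}}$, and let $\hat u^{\mu,\nu,t}=\mathbb V_{\mu,t}\hat q_{\mathrm D}(\mu,\nu,t)$ be the DOD+DNN approximation. Then, under assumptions (i) and (ii) of the context, its relative error satisfies $$\mathcal E_R^{\text{DOD+DNN}}\;\ge\;\frac mM\,\mathcal E'_{\mathrm{DOD},\infty},$$ where $$\mathcal E'_{\mathrm{DOD},\infty}:=m^{-1}\int_{\Theta\times[0,T]}\sqrt{\sum_{k>N'}\sigma(\mu,t)_{k,\infty}^2}\;d(\mu,t),$$ and $\sigma(\mu,t)_{1,\infty}^2\ge\sigma(\mu,t)_{2,\infty}^2\ge\cdots$ are the eigenvalues of the non-reduced continuous correlation matrix at $(\mu,t)$.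
   Context: **Setting.** Let $p,q\in\mathbb N$, $\Theta\subset\mathbb R^p$ and $\Theta'\subset\mathbb R^q$ compact, $T>0$, and $N'<N_A\le N_h$ fixed natural numbers. $\mathbb G\in\mathbb R^{N_h\times N_h}$ is symmetric positive definite, $\|u\|:=\sqrt{u^T\mathbb G u}$; $|\cdot|$ denotes the Euclidean norm of vectors and Lebesgue measure of sets. A matrix $W$ with $N_h$ rows is $\mathbb G$-orthonormal if $W^T\mathbb G W$ is the identity. For $(\mu,\nu,t)\in\Theta\times\Theta'\times[0,T]$, $u^{\mu,\nu,t}\in\mathbb R^{N_h}$ is the coefficient vector at time $t$ of the solution of a spatially discretized parametric parabolic PDE. **Assumptions.** (i) $m:=\operatorname{ess\,inf}\|u^{\mu,\nu,t}\|>0$, $M:=\operatorname{ess\,sup}\|u^{\mu,\nu,t}\|<\infty$, and $(\mu,\nu,t)\mapsto u^{\mu,\nu,t}$ is Lipschitz with constant $L>0$. (ii) The $N_s\ge2$ training parameters are sampled independently and identically distributed in $\Theta\times\Theta'$, with $N_{s_1}$ and $N_{s_2}$ the numbers of random samples in $\Theta$ and $\Theta'$, $N_s=N_{s_1}N_{s_2}$; times lie on the uniform grid $\{\Delta t,2\Delta t,\dots,N_t\Delta t\}$, $\Delta t=T/N_t$, $N_t\ge2$; $N_{\text{data}}=N_sN_t$. **Neural networks.** A network is $\Phi=((A_1,b_1),\dots,(A_K,b_K))$ with $A_l\in\mathbb R^{n_l\times\sum_{k<l}n_k}$, $b_l\in\mathbb R^{n_l}$; its realization $R_\rho(\Phi)$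 with ReLU activation $\rho$ is $x_l=\rho(A_l[x_0;\dots;x_{l-1}]+b_l)$ for $l<K$, $x_K=A_K[x_0;\dots;x_{K-1}]+b_K$, with input $x_0$ and output $x_K$. An architecture prescribes which entries may be nonzero; $\Theta(\Phi)$ is the space of real weights for those entries and $\Phi(\theta)$ the network with weights $\theta\in\Theta(\Phi)$. **DOD.** $\mathbb A\in\mathbb R^{N_h\times N_A}$ is the $\mathbb G$-orthonormal POD (proper orthogonal decomposition) matrix of the snapshots: its columns are the leading $N_A$ $\mathbb G$-orthonormal eigenvectors of $\frac{|\Theta\times\Theta'\times[0,T]|}{N_{\text{data}}}UU^T\mathbb G$, $U\in\mathbb R^{N_h\times N_{\text{data}}}$ being the matrix of all snapshots. The inner DOD (deep orthogonal decomposition) module is $\Phi_{\tilde{\mathbb V}}=\mathrm{ORTH}\circ\mathrm{STACK}\circ P(R_1\odot\mathsf s,\dots,R_{N'}\odot\mathsf s)$, with $\mathsf s$ a deep feed-forward network architecture with input dimension $p+1$ and output dimension $l$, $R_i$ deep feed-forward network architectures with input dimension $l$ and output dimension $N_A$, $\odot$ concatenation, $P$ parallelization, $\mathrm{STACK}:\mathbb R^{N_A\cdot N'}\to\mathbb R^{N_A\times N'}$ canonical stacking, and $\mathrm{ORTH}$ a span-preserving orthonormalization of an $N_A\times N'$ matrix (e.g. QR). For weights $\theta$, $\tilde{\mathbb V}_{\mu,t}(\theta):=R_\rho(\Phi_{\tilde{\mathbb V}}(\theta))(\mu,t)$ and $\mathbb V_{\mu,t}(\theta):=\mathbb A\tilde{\mathbb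 V}_{\mu,t}(\theta)\in\mathbb R^{N_h\times N'}$. **Choice of weights (DOD bound).** Let $\mathcal S^{\text{pre-red}}_{\mu,t}:=\{\mathbb A^T\mathbb G u^{\mu,\nu,t}:\nu\in\Theta'\}\subset\mathbb R^{N_A}$ and let $d_{N'}(\mathcal S^{\text{pre-red}}_{\mu,t}):=\inf_{\tilde{\mathbb V}\in\mathbb R^{N_A\times N'}}\sup_{w\in\mathcal S^{\text{pre-red}}_{\mu,t}}|w-\tilde{\mathbb V}\tilde{\mathbb V}^Tw|$ be its linear Kolmogorov $N'$-width. For arbitrary $\epsilon>0$, an architecture $\Phi_{\tilde{\mathbb V}}$ and weights $\theta^*_{\mathrm{DOD}}\in\Theta(\Phi_{\tilde{\mathbb V}})$ are chosen such that, with a constant $c_{\mathbb A}'>0$ depending only on $\mathbb A$, $N_A$ and the parameter space, $$\int_{\Theta\times\Theta'\times[0,T]}\|u^{\mu,\nu,t}-\mathbb V_{\mu,t}\mathbb V_{\mu,t}^T\mathbb G u^{\mu,\nu,t}\|^2d(\mu,\nu,t)\le\epsilon+c_{\mathbb A}'+\int_{\Theta\times[0,T]}d_{N'}(\mathcal S^{\text{pre-red}}_{\mu,t})^2\,d(\mu,t).$$ **Relative error.** $\mathcal E_R:=\Big(\int_{\Theta\times\Theta'\times[0,T]}\frac{\|u^{\mu,\nu,t}-\hat u^{\mu,\nu,t}\|^2}{\|u^{\mu,\nu,t}\|^2}d(\mu,\nu,t)\Big)^{1/2}$. **Non-reduced continuous correlation matrix.** At $(\mu,t)$ it is $\mathbb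 G^{1/2}\Big(\int_{\Theta'}u^{\mu,\nu,t}(u^{\mu,\nu,t})^T\,d\nu\Big)\mathbb G^{1/2}\in\mathbb R^{N_h\times N_h}$.
   Formalization: The formal theorem additionally assumes that the Lebesgue measure of Θ×[0,T] is at most 1; without this the stated inequality is false (for every larger volume there is a counterexample), as comparing the L² error with the L¹ integral costs a factor |Θ×[0,T]|^{1/2}. *)

theory Defs
  imports "Jordan_Normal_Form.Matrix" "HOL-Probability.Probability"
begin

(* Vectors and matrices of a network have sizes that vary from layer to layer, so they are
   Matrix.vec and Matrix.mat; everything living in a fixed dimension uses real^'n. *)
hide_const (open) Matrix.vec Matrix.mat
hide_type (open) Matrix.vec
no_notation vec_index (infixl \<open>$\<close> 100)

section \<open>Linear algebra\<close>

definition sym_pos_def :: "real^'h^'h \<Rightarrow> bool" where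
  "sym_pos_def G \<longleftrightarrow> transpose G = G \<and> (\<forall>x. x \<noteq> 0 \<longrightarrow> 0 < x \<bullet> (G *v x))"

definition gnorm :: "real^'h^'h \<Rightarrow> real^'h \<Rightarrow> real" where
  "gnorm G u = sqrt (u \<bullet> (G *v u))"

definition matrix_sqrt :: "real^'h^'h \<Rightarrow> real^'h^'h" where
  "matrix_sqrt G = (THE S. sym_pos_def S \<and> S ** S = G)"

(* eigval 1, ..., eigval N are the eigenvalues of the N x N matrix C in nonincreasing order,
   repeated according to their multiplicity as roots of the characteristic polynomial (which is required
   to split over the reals); values of eigval outside {1..N} are irrelevant. *)
definition eigenvalues_desc :: "real^'m^'m \<Rightarrow> (nat \<Rightarrow> real) \<Rightarrow> bool" where
  "eigenvalues_desc C eigval \<longleftrightarrow>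
     antimono_on {1..CARD('m)} eigval \<and>
     (\<forall>x. det (mat x - C) = (\<Prod>k = 1..CARD('m). x - eigval k))"

(* For rank-deficient W the span of the N' orthonormal columns of orth W is larger than that of W,
   for W of full rank the inclusion is an equality. Borel measurability (which QR or Gram-Schmidt
   have) is what makes the integrals over the parameter domain meaningful. *)
definition orthonormalization :: "(real^'n^'a \<Rightarrow> real^'n^'a) \<Rightarrow> bool" where
  "orthonormalization orth \<longleftrightarrow>
     orth \<in> borel_measurable borel \<and>
     (\<forall>W. transpose (orth W) ** orth W = mat 1 \<and>
          span (columns W) \<subseteq> span (columns (orth W)))"

definition kolmogorov_width :: "'n::finite itself \<Rightarrow> (real^'a) set \<Rightarrow> real" where
  "kolmogorov_width _ S =
     (INF V :: real^'n^'a. SUP w\<in>S. norm (w - V *v (transpose V *v w)))"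

section \<open>Parameter domain, essential bounds, errors\<close>

abbreviation param_dom ::
  "(real^'p) set \<Rightarrow> (real^'q) set \<Rightarrow> real \<Rightarrow> ((real^'p) \<times> (real^'q) \<times> real) set" where
  "param_dom \<Theta> \<Theta>' T \<equiv> \<Theta> \<times> \<Theta>' \<times> {0..T}"

definition ess_sup_on :: "'x::euclidean_space set \<Rightarrow> ('x \<Rightarrow> real) \<Rightarrow> ereal" where
  "ess_sup_on D f = esssup (restrict_space lborel D) (\<lambda>x. ereal (f x))"

definition ess_inf_on :: "'x::euclidean_space set \<Rightarrow> ('x \<Rightarrow> real) \<Rightarrow> ereal" where
  "ess_inf_on D f = - esssup (restrict_space lborel D) (\<lambda>x. - ereal (f x))"

(* An L2 quantity. A lower bound for it by an L1 integral over a domain D, as in the error estimate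
   for the DOD+DNN approximation, goes through Cauchy-Schwarz and costs a factor sqrt |D|; that
   estimate is therefore restricted to |D| <= 1; it fails in general for |D| > 1. *)
definition relative_error ::
  "real^'h^'h \<Rightarrow> 'x::euclidean_space set \<Rightarrow> ('x \<Rightarrow> real^'h) \<Rightarrow> ('x \<Rightarrow> real^'h) \<Rightarrow> real" where
  "relative_error G D u uhat =
     sqrt (LINT x:D|lborel. (gnorm G (u x - uhat x))\<^sup>2 / (gnorm G (u x))\<^sup>2)"

definition correlation_matrix ::
  "real^'h^'h \<Rightarrow> (real^'q) set \<Rightarrow> ((real^'p) \<times> (real^'q) \<times> real \<Rightarrow> real^'h) \<Rightarrow> real^'p \<Rightarrow> real
     \<Rightarrow> real^'h^'h" where
  "correlation_matrix G \<Theta>' u \<mu> t =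
     matrix_sqrt G ** (\<chi> i j. LINT \<nu>:\<Theta>'|lborel. u (\<mu>, \<nu>, t) $ i * u (\<mu>, \<nu>, t) $ j)
       ** matrix_sqrt G"

section \<open>Sampling and POD\<close>

definition iid_in ::
  "'w measure \<Rightarrow> (nat \<Rightarrow> 'w \<Rightarrow> 'x::euclidean_space) \<Rightarrow> nat set \<Rightarrow> 'x set \<Rightarrow> bool" where
  "iid_in P X I S \<longleftrightarrow>
     prob_space.indep_vars P (\<lambda>_. borel) X I \<and>
     (\<forall>i\<in>I. \<forall>j\<in>I. distr P borel (X i) = distr P borel (X j)) \<and>
     (\<forall>i\<in>I. \<forall>\<omega>\<in>space P. X i \<omega> \<in> S)"

(* The training parameters are all pairs (X i, Y j) of the Ns1 samples X i in the first and the
   Ns2 samples Y j in the second parameter set. The independence of the X-family from the Y-family is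
   stated on the generated sigma-algebras because indep_var needs both variables to have one type. *)
definition training_samples ::
  "'w measure \<Rightarrow> (nat \<Rightarrow> 'w \<Rightarrow> real^'p) \<Rightarrow> (nat \<Rightarrow> 'w \<Rightarrow> real^'q) \<Rightarrow> nat \<Rightarrow> nat
     \<Rightarrow> (real^'p) set \<Rightarrow> (real^'q) set \<Rightarrow> bool" where
  "training_samples P X Y Ns1 Ns2 \<Theta> \<Theta>' \<longleftrightarrow>
     prob_space P \<and> iid_in P X {1..Ns1} \<Theta> \<and> iid_in P Y {1..Ns2} \<Theta>' \<and>
     prob_space.indep_set P
       {(\<lambda>\<omega>. \<lambda>i\<in>{1..Ns1}. X i \<omega>) -` B \<inter> space P | B. B \<in> sets (\<Pi>\<^sub>M i\<in>{1..Ns1}. borel)}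
       {(\<lambda>\<omega>. \<lambda>j\<in>{1..Ns2}. Y j \<omega>) -` B \<inter> space P | B. B \<in> sets (\<Pi>\<^sub>M j\<in>{1..Ns2}. borel)}"

(* U U^T, the sum of the outer products of the snapshots (the columns of U) *)
definition snapshot_gram ::
  "((real^'p) \<times> (real^'q) \<times> real \<Rightarrow> real^'h) \<Rightarrow> (nat \<Rightarrow> real^'p) \<Rightarrow> (nat \<Rightarrow> real^'q)
     \<Rightarrow> nat \<Rightarrow> nat \<Rightarrow> nat \<Rightarrow> real \<Rightarrow> real^'h^'h" where
  "snapshot_gram u \<mu>s \<nu>s Ns1 Ns2 Nt T =
     (\<Sum>(i, j, k) \<in> {1..Ns1} \<times> {1..Ns2} \<times> {1..Nt}.
        let w = u (\<mu>s i, \<nu>s j, real k * (T / real Nt)) in (\<chi> a b. w $ a * w $ b))"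

(* The columns of A belong to the CARD('a) largest eigenvalues of K = (vol / Ndata) U U^T G;
   the k-th column (counted from 0) is the one with index from_nat_into UNIV k. *)
definition pod_matrix :: "real^'h^'h \<Rightarrow> real^'h^'h \<Rightarrow> real^'a^'h \<Rightarrow> bool" where
  "pod_matrix G K A \<longleftrightarrow>
     transpose A ** G ** A = mat 1 \<and>
     (\<exists>eigval. eigenvalues_desc K eigval \<and>
        (\<forall>c :: 'a. K *v column c A = eigval (Suc (to_nat_on UNIV c)) *\<^sub>R column c A))"

section \<open>Neural networks\<close>

(* Coordinates of real^'k are enumerated by to_nat_on, an arbitrary but fixed bijection onto
   {..<CARD('k)}. *)
definition to_coords :: "real^'k \<Rightarrow> real Matrix.vec" where
  "to_coords x = Matrix.vec CARD('k) (\<lambda>i. x $ from_nat_into UNIV i)"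

definition of_coords :: "real Matrix.vec \<Rightarrow> real^'k" where
  "of_coords v = (\<chi> i. vec_index v (to_nat_on UNIV i))"

type_synonym network = "(real Matrix.mat \<times> real Matrix.vec) list"

definition relu :: "real Matrix.vec \<Rightarrow> real Matrix.vec" where
  "relu = map_vec (\<lambda>x. max 0 x)"

(* The second argument is the concatenation [x_0; ...; x_(l-1)] of the input and all previous
   layers. *)
fun realization :: "network \<Rightarrow> real Matrix.vec \<Rightarrow> real Matrix.vec" where
  "realization [] h = h"
| "realization [(A, b)] h = A *\<^sub>v h + b"
| "realization ((A, b) # L # Ls) h = realization (L # Ls) (h @\<^sub>v relu (A *\<^sub>v h + b))"

(* Layers and indices count from 0: Weight l i j is the entry (i, j) of the weight matrix and
   Bias l i the entry i of the bias of layer l + 1. *)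
datatype entry = Weight nat nat nat | Bias nat nat

record arch =
  in_dim :: nat
  widths :: "nat list"
  free_entries :: "entry set"

type_synonym weights = "entry \<Rightarrow> real"

definition arch_io :: "arch \<Rightarrow> nat \<Rightarrow> nat \<Rightarrow> bool" where
  "arch_io \<Phi> d e \<longleftrightarrow> in_dim \<Phi> = d \<and> widths \<Phi> \<noteq> [] \<and> last (widths \<Phi>) = e"

definition weight_space :: "arch \<Rightarrow> weights set" where
  "weight_space \<Phi> = {\<theta>. \<forall>e. e \<notin> free_entries \<Phi> \<longrightarrow> \<theta> e = 0}"

definition network_of :: "arch \<Rightarrow> weights \<Rightarrow> network" where
  "network_of \<Phi> \<theta> =
     map (\<lambda>l. (Matrix.mat (widths \<Phi> ! l) (in_dim \<Phi> + sum_list (take l (widths \<Phi>)))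
                 (\<lambda>(i, j). \<theta> (Weight l i j)),
               Matrix.vec (widths \<Phi> ! l) (\<lambda>i. \<theta> (Bias l i))))
       [0..<length (widths \<Phi>)]"

section \<open>Inner DOD module\<close>

(* One seed network shared by all roots. *)
record dod_arch =
  seed :: arch
  roots :: "arch list"

type_synonym dod_weights = "weights \<times> (nat \<Rightarrow> weights)"

definition dod_arch_io :: "dod_arch \<Rightarrow> nat \<Rightarrow> nat \<Rightarrow> nat \<Rightarrow> bool" where
  "dod_arch_io \<Phi> p NA N \<longleftrightarrow>
     length (roots \<Phi>) = N \<and>
     (\<exists>l. arch_io (seed \<Phi>) (p + 1) l \<and> (\<forall>R\<in>set (roots \<Phi>). arch_io R l NA))"

definition dod_weight_space :: "dod_arch \<Rightarrow> dod_weights set" where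
  "dod_weight_space \<Phi> =
     {(\<theta>s, \<theta>r). \<theta>s \<in> weight_space (seed \<Phi>) \<and>
        (\<forall>i<length (roots \<Phi>). \<theta>r i \<in> weight_space (roots \<Phi> ! i))}"

(* Realization of P(R_1 o s, ..., R_N' o s): on realizations, concatenation of networks is
   composition of functions and parallelization juxtaposes the outputs. *)
definition dod_parallel :: "dod_arch \<Rightarrow> dod_weights \<Rightarrow> real Matrix.vec \<Rightarrow> real Matrix.vec" where
  "dod_parallel \<Phi> \<theta> x =
     (let s = realization (network_of (seed \<Phi>) (fst \<theta>)) x in
      vec_of_list (concat (map
        (\<lambda>i. list_of_vec (realization (network_of (roots \<Phi> ! i) (snd \<theta> i)) s))
        [0..<length (roots \<Phi>)])))"

(* column c of the matrix is the c-th block of length CARD('a), i.e. the output of root c *)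
definition stack :: "real Matrix.vec \<Rightarrow> real^'n^'a" where
  "stack v = (\<chi> r c. vec_index v (to_nat_on UNIV c * CARD('a) + to_nat_on UNIV r))"

definition dod_inner ::
  "(real^'n^'a \<Rightarrow> real^'n^'a) \<Rightarrow> dod_arch \<Rightarrow> dod_weights \<Rightarrow> real^'p \<Rightarrow> real \<Rightarrow> real^'n^'a" where
  "dod_inner orth \<Phi> \<theta> \<mu> t =
     orth (stack (dod_parallel \<Phi> \<theta> (to_coords \<mu> @\<^sub>v vec_of_list [t])))"

definition dod_basis ::
  "(real^'n^'a \<Rightarrow> real^'n^'a) \<Rightarrow> real^'a^'h \<Rightarrow> dod_arch \<Rightarrow> dod_weights \<Rightarrow> real^'p \<Rightarrow> real
     \<Rightarrow> real^'n^'h" where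
  "dod_basis orth A \<Phi> \<theta> \<mu> t = A ** dod_inner orth \<Phi> \<theta> \<mu> t"

definition pre_reduced_set ::
  "real^'h^'h \<Rightarrow> real^'a^'h \<Rightarrow> (real^'q) set \<Rightarrow> ((real^'p) \<times> (real^'q) \<times> real \<Rightarrow> real^'h)
     \<Rightarrow> real^'p \<Rightarrow> real \<Rightarrow> (real^'a) set" where
  "pre_reduced_set G A \<Theta>' u \<mu> t = {transpose A *v (G *v u (\<mu>, \<nu>, t)) | \<nu>. \<nu> \<in> \<Theta>'}"

definition dod_bound ::
  "real^'h^'h \<Rightarrow> (real^'p) set \<Rightarrow> (real^'q) set \<Rightarrow> real
     \<Rightarrow> ((real^'p) \<times> (real^'q) \<times> real \<Rightarrow> real^'h) \<Rightarrow> real^'a^'h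
     \<Rightarrow> (real^'p \<Rightarrow> real \<Rightarrow> real^'n^'h) \<Rightarrow> real \<Rightarrow> real \<Rightarrow> bool" where
  "dod_bound G \<Theta> \<Theta>' T u A V \<epsilon> c \<longleftrightarrow>
     (LINT x:param_dom \<Theta> \<Theta>' T|lborel. (case x of (\<mu>, \<nu>, t) \<Rightarrow>
        (gnorm G (u (\<mu>, \<nu>, t)
           - V \<mu> t *v (transpose (V \<mu> t) *v (G *v u (\<mu>, \<nu>, t)))))\<^sup>2))
     \<le> \<epsilon> + c + (LINT y:\<Theta> \<times> {0..T}|lborel. (case y of (\<mu>, t) \<Rightarrow>
        (kolmogorov_width TYPE('n) (pre_reduced_set G A \<Theta>' u \<mu> t))\<^sup>2))"

end

theory Submission
  imports Defs
begin

text \<open>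
  At a fixed parameter and time \<open>(\<mu>, t)\<close>, the approximation \<open>uhat\<close> takes its values, as \<open>\<nu>\<close> varies, in
  the range of the one matrix \<open>V \<mu> t\<close>, whose dimension is at most \<open>N' = CARD('n)\<close>. No family of vectors
  in an \<open>N'\<close>-dimensional space comes closer to \<open>u (\<mu>, \<cdot>, t)\<close> in mean square than its projection onto
  the best such space, and that distance is an eigenvalue tail. In detail, put \<open>S = matrix_sqrt G\<close>, so
  that the \<open>G\<close>-norm of \<open>v\<close> is the Euclidean norm of \<open>S v\<close> (\<open>gnorm_eq_norm_sqrt\<close>).
  If \<open>B\<close> is an orthonormal basis of the range of \<open>S V\<close>, then the integral of the squared error over \<open>\<Theta>'\<close> is at least \<open>trace C - (\<Sum>e\<in>B. e \<bullet> C e)\<close>, where \<open>C\<close> is the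
  correlation matrix, and Ky Fan's maximum principle bounds this below by the sum of the eigenvalues of \<open>C\<close>
  with index above \<open>N'\<close> (\<open>eigenvalue_tail_le\<close>, \<open>eigenvalue_tail_le_fiber_error\<close>).

  Three steps lead from the fibres to the relative error. Bounding the denominator by \<open>M\<close> costs the factor
  \<open>1 / M\<close> (\<open>squared_error_le_relative_error\<close>), Tonelli's theorem turns the integral over the whole domain into
  one over \<open>(\<mu>, t)\<close> of the fibre errors (\<open>nn_integral_lborel_middle\<close>), and Cauchy-Schwarz on
  \<open>\<Theta> \<times> [0, T]\<close>, a set of measure at most \<open>1\<close>, replaces the square integral of the root of the tail by the
  square of its integral (\<open>square_set_integral_le_nn_integral\<close>).

  Because the Bochner integral of a function that is not integrable is \<open>0\<close>, the relative error is a
  meaningful upper bound only once its integrand is known to be integrable. This is where the measurability of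
  the orthonormalization and the continuity of the networks enter: \<open>uhat\<close> is measurable and bounded on the
  compact domain, while the norm of \<open>u\<close> is essentially bounded away from \<open>0\<close>. The same convention spares a
  proof that the eigenvalues depend measurably on \<open>(\<mu>, t)\<close>: where the root of the tail is not integrable, the
  claim reads \<open>0 \<le> relative_error\<close>.
\<close>

section \<open>The spectral theorem and square roots of positive definite matrices\<close>

lemma inner_matrix_mult_right:
  fixes A :: "real^'n^'m"
  shows "x \<bullet> (A *v y) = (transpose A *v x) \<bullet> y"
  by (simp add: dot_lmul_matrix transpose_matrix_vector)

lemma inner_symmetric_matrix:
  fixes A :: "real^'n^'n"
  assumes "transpose A = A"
  shows "x \<bullet> (A *v y) = (A *v x) \<bullet> y"
  using inner_matrix_mult_right[of x A y] assms by simp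

text \<open>
  The default orientation turns \<open>transpose A *v x\<close> into \<open>x v* A\<close>, which hides the coordinates of \<open>x\<close>
  with respect to the columns of an orthogonal matrix \<open>A\<close>.
\<close>
declare transpose_matrix_vector [simp del]

text \<open>
  A maximizer \<open>v\<close> of the Rayleigh quotient on the unit sphere of the subspace is an eigenvector: otherwise
  the residual \<open>y = C v - c v\<close>, which lies in the subspace by invariance, would be a direction of ascent.
\<close>
lemma symmetric_invariant_subspace_eigenvector:
  fixes C :: "real^'n^'n"
  assumes sym: "transpose C = C" and S: "subspace S" "S \<noteq> {0}"
    and inv: "\<And>x. x \<in> S \<Longrightarrow> C *v x \<in> S"
  obtains v c where "v \<in> S" "norm v = 1" "C *v v = c *\<^sub>R v"
proof -
  let ?K = "S \<inter> sphere 0 1"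
  have "compact ?K"
    using closed_subspace[OF S(1)] by (simp add: closed_Int_compact)
  moreover have "?K \<noteq> {}"
  proof -
    obtain x where "x \<in> S" "x \<noteq> 0" using S subspace_0 by blast
    then have "x /\<^sub>R norm x \<in> ?K" using S(1) by (simp add: subspace_scale)
    then show ?thesis by blast
  qed
  moreover have "continuous_on ?K (\<lambda>x. x \<bullet> (C *v x))"
    by (intro continuous_intros)
  ultimately obtain v where v: "v \<in> ?K"
    and max: "\<And>x. x \<in> ?K \<Longrightarrow> x \<bullet> (C *v x) \<le> v \<bullet> (C *v v)"
    using continuous_attains_sup[of ?K "\<lambda>x. x \<bullet> (C *v x)"] by blast
  define c where "c = v \<bullet> (C *v v)"
  define q where "q x = x \<bullet> (C *v x) - c * (x \<bullet> x)" for x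
  have vv: "v \<bullet> v = 1" using v by (simp add: dot_square_norm)
  have q_le: "q x \<le> 0" if "x \<in> S" for x
  proof (cases "x = 0")
    case False
    then have "x /\<^sub>R norm x \<in> ?K" using S(1) that by (simp add: subspace_scale)
    from max[OF this] have "(x \<bullet> (C *v x)) / (norm x)\<^sup>2 \<le> c"
      by (simp add: matrix_vector_mult_scaleR c_def power2_eq_square divide_inverse_commute mult.assoc)
    then show ?thesis using False by (simp add: q_def divide_le_eq dot_square_norm)
  qed (simp add: q_def)
  define y where "y = C *v v - c *\<^sub>R v"
  have y: "y \<in> S" using v S(1) inv by (simp add: y_def subspace_diff subspace_scale)
  have expand: "q (v + s *\<^sub>R y) = s * (2 * (y \<bullet> y) + s * q y)" for s
  proof -
    have "y \<bullet> (C *v v) - c * (y \<bullet> v) = y \<bullet> y"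
      using inner_diff_right[of y "C *v v" "c *\<^sub>R v"] by (simp add: y_def)
    moreover have "v \<bullet> (C *v y) = y \<bullet> (C *v v)"
      using sym by (simp add: inner_symmetric_matrix[of C v] inner_commute)
    moreover have "q (v + s *\<^sub>R y) = (v \<bullet> (C *v v) - c * (v \<bullet> v))
        + s * ((y \<bullet> (C *v v) - c * (y \<bullet> v)) + (v \<bullet> (C *v y) - c * (v \<bullet> y))) + s * s * q y"
      unfolding q_def matrix_vector_right_distrib matrix_vector_mult_scaleR inner_add_left
        inner_add_right inner_scaleR_left inner_scaleR_right by (simp add: algebra_simps)
    ultimately show ?thesis using vv by (simp add: c_def inner_commute[of v y] ring_distribs)
  qed
  have "y \<bullet> y = 0"
  proof (rule ccontr)
    assume "y \<bullet> y \<noteq> 0"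
    then have a: "0 < y \<bullet> y" by (simp add: inner_gt_zero_iff)
    \<comment> \<open>a step so short that the quadratic term cannot cancel the gain \<open>2 s |y|\<^sup>2\<close>\<close>
    define s where "s = (y \<bullet> y) / (\<bar>q y\<bar> + 1)"
    have s: "0 < s" using a by (simp add: s_def)
    have "s * \<bar>q y\<bar> \<le> y \<bullet> y" using a by (simp add: s_def field_simps)
    then have "- (s * q y) \<le> y \<bullet> y"
      using s by (smt (verit) mult_minus_right mult_left_mono)
    then have "0 < 2 * (y \<bullet> y) + s * q y" using a by linarith
    then have "0 < s * (2 * (y \<bullet> y) + s * q y)" using s by (intro mult_pos_pos)
    moreover have "v + s *\<^sub>R y \<in> S" using v y S(1) by (simp add: subspace_add subspace_scale)
    ultimately show False using q_le[of "v + s *\<^sub>R y"] by (simp add: expand)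
  qed
  then have "C *v v = c *\<^sub>R v" by (simp add: y_def)
  with v that show ?thesis by auto
qed

definition diagonal :: "('n \<Rightarrow> real) \<Rightarrow> real^'n^'n" where
  "diagonal d = (\<chi> i j. if i = j then d i else 0)"

text \<open>
  The orthogonal complement of a set of eigenvectors of a symmetric matrix is invariant, so that a further
  eigenvector can be found there as long as the set does not span the space.
\<close>
lemma symmetric_orthonormal_eigenvectors:
  fixes C :: "real^'n^'n"
  assumes sym: "transpose C = C"
  shows "k \<le> CARD('n) \<Longrightarrow> \<exists>B. finite B \<and> card B = k \<and> pairwise orthogonal B \<and>
           (\<forall>x\<in>B. norm x = 1 \<and> (\<exists>c. C *v x = c *\<^sub>R x))"
proof (induction k)
  case (Suc k)
  then obtain B where B: "finite B" "card B = k" "pairwise orthogonal B"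
    "\<And>x. x \<in> B \<Longrightarrow> norm x = 1" "\<And>x. x \<in> B \<Longrightarrow> \<exists>c. C *v x = c *\<^sub>R x"
    by auto
  let ?S = "{y. \<forall>x\<in>B. orthogonal x y}"
  have sub: "subspace ?S"
    by (auto simp: subspace_def orthogonal_def inner_add_right)
  have "dim B < DIM(real^'n)"
    using Suc.prems dim_le_card'[OF B(1)] B(2) by simp
  then obtain z where "z \<noteq> 0" "\<And>y. y \<in> span B \<Longrightarrow> orthogonal z y"
    using orthogonal_to_subspace_exists by blast
  then have "z \<in> ?S" "z \<noteq> 0" by (auto intro: span_base simp: orthogonal_commute[of _ z])
  then have "?S \<noteq> {0}" by blast
  moreover have "C *v y \<in> ?S" if "y \<in> ?S" for y
  proof -
    have "orthogonal x (C *v y)" if "x \<in> B" for x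
    proof -
      obtain c where "C *v x = c *\<^sub>R x" using B(5) \<open>x \<in> B\<close> by blast
      then show ?thesis
        using \<open>y \<in> ?S\<close> \<open>x \<in> B\<close> sym by (simp add: orthogonal_def inner_symmetric_matrix)
    qed
    then show ?thesis by simp
  qed
  ultimately obtain v c where v: "v \<in> ?S" "norm v = 1" "C *v v = c *\<^sub>R v"
    by (rule symmetric_invariant_subspace_eigenvector[OF sym sub])
  have "v \<notin> B"
    using v(1,2) by (auto simp: orthogonal_def)
  then have "finite (insert v B) \<and> card (insert v B) = Suc k \<and> pairwise orthogonal (insert v B) \<and>
      (\<forall>x\<in>insert v B. norm x = 1 \<and> (\<exists>c. C *v x = c *\<^sub>R x))"
    using B v by (auto simp: pairwise_insert orthogonal_commute)
  then show ?case by blast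
qed (auto intro: exI[of _ "{}"])

text \<open>
  The spectral theorem: the columns of \<open>Q\<close> are a maximal orthonormal set of eigenvectors.
\<close>
lemma symmetric_diagonalizable:
  fixes C :: "real^'n^'n"
  assumes "transpose C = C"
  obtains Q :: "real^'n^'n" and d where "transpose Q ** Q = mat 1" "Q ** transpose Q = mat 1"
    "C = Q ** diagonal d ** transpose Q"
proof -
  obtain B where B: "finite B" "card B = CARD('n)" "pairwise orthogonal B"
    "\<And>x. x \<in> B \<Longrightarrow> norm x = 1" "\<And>x. x \<in> B \<Longrightarrow> \<exists>c. C *v x = c *\<^sub>R x"
    using symmetric_orthonormal_eigenvectors[OF assms order_refl] by auto
  obtain b where b: "bij_betw b (UNIV :: 'n set) B"
    using finite_same_card_bij[of "UNIV :: 'n set" B] B(1,2) by auto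
  then have bB: "b i \<in> B" for i by (auto dest: bij_betwE)
  obtain d where d: "\<And>i. C *v b i = d i *\<^sub>R b i" using B(5)[OF bB] by metis
  define Q :: "real^'n^'n" where "Q = (\<chi> i j. b j $ i)"
  have ortho: "b i \<bullet> b j = (if i = j then 1 else 0)" for i j
  proof (cases "i = j")
    case False
    then have "b i \<noteq> b j" using b by (auto simp: bij_betw_def inj_on_def)
    then show ?thesis using B(3) bB False by (auto simp: pairwise_def orthogonal_def)
  qed (use B(4) bB in \<open>simp add: dot_square_norm\<close>)
  have QQ: "transpose Q ** Q = mat 1"
    using ortho by (simp add: vec_eq_iff matrix_matrix_mult_def transpose_def Q_def mat_def inner_vec_def)
  then have QQ': "Q ** transpose Q = mat 1" by (simp add: matrix_left_right_inverse)
  have "C ** Q = Q ** diagonal d"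
  proof -
    have "(C ** Q) $ i $ j = (C *v b j) $ i" for i j
      by (simp add: matrix_matrix_mult_def matrix_vector_mult_def Q_def)
    moreover have "(Q ** diagonal d) $ i $ j = (d j *\<^sub>R b j) $ i" for i j
      by (simp add: matrix_matrix_mult_def Q_def diagonal_def if_distrib cong: if_cong)
    ultimately show ?thesis using d by (simp add: vec_eq_iff)
  qed
  then have "C = Q ** diagonal d ** transpose Q"
    by (metis QQ' matrix_mul_assoc matrix_mul_rid)
  with QQ QQ' that show ?thesis by blast
qed

lemma norm_orthonormal_columns:
  fixes Q :: "real^'n^'m"
  assumes "transpose Q ** Q = mat 1"
  shows "norm (Q *v x) = norm x"
  using assms by (simp add: norm_eq_sqrt_inner inner_matrix_mult_right[of "Q *v x"] matrix_vector_mul_assoc)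

lemma diagonal_mult_vector: "diagonal d *v x = (\<chi> i. d i * x $ i)"
  by (simp add: vec_eq_iff matrix_vector_mult_def diagonal_def if_distrib[of "\<lambda>y. y * _"] cong: if_cong)

lemma transpose_diagonal [simp]: "transpose (diagonal d) = diagonal d"
  by (simp add: vec_eq_iff transpose_def diagonal_def)

lemma diagonal_mult: "diagonal c ** diagonal d = diagonal (\<lambda>i. c i * d i)"
  by (simp add: vec_eq_iff matrix_matrix_mult_def diagonal_def if_distrib[of "\<lambda>y. y * _"] cong: if_cong)

lemma quadratic_form_diagonalized:
  fixes Q :: "real^'n^'n"
  assumes "C = Q ** diagonal d ** transpose Q"
  shows "x \<bullet> (C *v x) = (\<Sum>i\<in>UNIV. d i * ((transpose Q *v x) $ i)\<^sup>2)"
proof -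
  have "x \<bullet> (C *v x) = x \<bullet> (Q *v (diagonal d *v (transpose Q *v x)))"
    by (simp add: assms matrix_vector_mul_assoc matrix_mul_assoc)
  also have "\<dots> = (transpose Q *v x) \<bullet> (diagonal d *v (transpose Q *v x))"
    by (rule inner_matrix_mult_right)
  finally show ?thesis
    by (simp add: diagonal_mult_vector inner_vec_def power2_eq_square mult_ac)
qed

lemma pos_def_diagonalized:
  fixes Q :: "real^'n^'n"
  assumes Q: "transpose Q ** Q = mat 1" "Q ** transpose Q = mat 1"
  shows "sym_pos_def (Q ** diagonal d ** transpose Q) \<longleftrightarrow> (\<forall>i. 0 < d i)"
proof
  assume pd: "sym_pos_def (Q ** diagonal d ** transpose Q)"
  show "\<forall>i. 0 < d i"
  proof
    fix i
    have QtQ: "transpose Q *v (Q *v axis i 1) = axis i 1"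
      using Q(1) by (simp add: matrix_vector_mul_assoc)
    then have "Q *v axis i 1 \<noteq> 0" by (metis axis_eq_0_iff matrix_vector_mult_0_right zero_neq_one)
    with pd have "0 < (Q *v axis i 1) \<bullet> ((Q ** diagonal d ** transpose Q) *v (Q *v axis i 1))"
      by (simp add: sym_pos_def_def)
    also have "\<dots> = (\<Sum>j\<in>UNIV. d j * (axis i 1 $ j)\<^sup>2)"
      by (simp only: quadratic_form_diagonalized[OF refl] QtQ)
    also have "\<dots> = (\<Sum>j\<in>UNIV. if j = i then d j else 0)"
      by (intro sum.cong) (auto simp: axis_def)
    finally show "0 < d i" by simp
  qed
next
  assume pos: "\<forall>i. 0 < d i"
  have "0 < x \<bullet> ((Q ** diagonal d ** transpose Q) *v x)" if "x \<noteq> 0" for x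
  proof -
    have "transpose Q *v x \<noteq> 0"
      using Q(2) that by (metis matrix_vector_mul_assoc matrix_vector_mul_lid matrix_vector_mult_0_right)
    then obtain j where "(transpose Q *v x) $ j \<noteq> 0" by (auto simp: vec_eq_iff)
    then show ?thesis
      unfolding quadratic_form_diagonalized[OF refl] using pos
      by (intro sum_pos2[of _ j]) (auto simp: less_imp_le)
  qed
  then show "sym_pos_def (Q ** diagonal d ** transpose Q)"
    by (simp add: sym_pos_def_def matrix_transpose_mul matrix_mul_assoc)
qed

text \<open>
  If \<open>x\<close> is an eigenvector of the symmetric matrix \<open>R - S\<close> with eigenvalue \<open>c\<close>, then
  \<open>R\<^sup>2 = S\<^sup>2\<close> gives \<open>0 = |R x|\<^sup>2 - |S x|\<^sup>2 = c (x \<bullet> R x + x \<bullet> S x)\<close>, and the second factor is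
  positive. So all eigenvalues of \<open>R - S\<close> vanish.
\<close>
lemma pos_def_sqrt_unique:
  fixes R S :: "real^'n^'n"
  assumes R: "sym_pos_def R" and S: "sym_pos_def S" and eq: "R ** R = S ** S"
  shows "R = S"
proof -
  have "transpose (R - S) = R - S"
    using R S by (simp add: sym_pos_def_def transpose_def vec_eq_iff)
  then obtain Q :: "real^'n^'n" and d where Q: "transpose Q ** Q = mat 1" "Q ** transpose Q = mat 1"
    and RS: "R - S = Q ** diagonal d ** transpose Q"
    by (rule symmetric_diagonalizable)
  have "d i = 0" for i
  proof -
    define x where "x = Q *v axis i 1"
    have QtQ: "transpose Q *v x = axis i 1"
      using Q(1) by (simp add: x_def matrix_vector_mul_assoc)
    then have x: "x \<noteq> 0" by (metis axis_eq_0_iff matrix_vector_mult_0_right zero_neq_one)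
    have "diagonal d *v axis i 1 = d i *\<^sub>R axis i 1"
      by (simp add: vec_eq_iff diagonal_mult_vector axis_def)
    then have "(R - S) *v x = d i *\<^sub>R x"
      using QtQ by (simp add: RS x_def matrix_vector_mult_scaleR flip: matrix_vector_mul_assoc)
    then have Rx: "R *v x = S *v x + d i *\<^sub>R x" by (simp add: algebra_simps matrix_vector_mult_diff_rdistrib)
    have "R *v (R *v x) = S *v (S *v x)" using eq by (simp add: matrix_vector_mul_assoc)
    moreover have "x \<bullet> (R *v (R *v x)) = (R *v x) \<bullet> (R *v x)" "x \<bullet> (S *v (S *v x)) = (S *v x) \<bullet> (S *v x)"
      using R S by (simp_all add: inner_symmetric_matrix[of R x] inner_symmetric_matrix[of S x] sym_pos_def_def)
    ultimately have "(R *v x) \<bullet> (R *v x) = (S *v x) \<bullet> (S *v x)" by simp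
    moreover have "(R *v x) \<bullet> (R *v x) - (S *v x) \<bullet> (S *v x) = (R *v x - S *v x) \<bullet> (R *v x + S *v x)"
      by (simp add: inner_diff_left inner_add_right inner_commute[of "S *v x" "R *v x"])
    moreover have "R *v x - S *v x = d i *\<^sub>R x" using Rx by simp
    ultimately have "d i * (x \<bullet> (R *v x) + x \<bullet> (S *v x)) = 0"
      by (simp add: inner_add_right distrib_left)
    moreover have "0 < x \<bullet> (R *v x) + x \<bullet> (S *v x)"
      using R S x by (simp add: sym_pos_def_def add_pos_pos)
    ultimately show ?thesis by simp
  qed
  then have "d = (\<lambda>i. 0)" by auto
  then have "diagonal d = 0" by (simp add: diagonal_def vec_eq_iff)
  then have "R - S = 0" by (simp add: RS matrix_matrix_mult_def vec_eq_iff)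
  then show ?thesis by simp
qed

text \<open>
  The definite description in \<^const>\<open>matrix_sqrt\<close> is meaningful: existence comes from taking square
  roots of the eigenvalues.
\<close>
lemma matrix_sqrt_correct:
  fixes G :: "real^'n^'n"
  assumes "sym_pos_def G"
  shows "sym_pos_def (matrix_sqrt G)" "matrix_sqrt G ** matrix_sqrt G = G"
proof -
  obtain Q :: "real^'n^'n" and d where Q: "transpose Q ** Q = mat 1" "Q ** transpose Q = mat 1"
    and G: "G = Q ** diagonal d ** transpose Q"
    using symmetric_diagonalizable[of G] assms unfolding sym_pos_def_def by blast
  have d: "0 < d i" for i using assms pos_def_diagonalized[OF Q] unfolding G by blast
  define S where "S = Q ** diagonal (\<lambda>i. sqrt (d i)) ** transpose Q"
  have "S ** S = Q ** diagonal (\<lambda>i. sqrt (d i)) ** (transpose Q ** Q)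
      ** diagonal (\<lambda>i. sqrt (d i)) ** transpose Q"
    by (simp add: S_def matrix_mul_assoc)
  also have "\<dots> = Q ** (diagonal (\<lambda>i. sqrt (d i)) ** diagonal (\<lambda>i. sqrt (d i))) ** transpose Q"
    using Q(1) by (simp add: matrix_mul_assoc)
  also have "\<dots> = G" using d by (simp add: diagonal_mult G less_imp_le)
  finally have "S ** S = G" .
  moreover have "sym_pos_def S" unfolding S_def pos_def_diagonalized[OF Q] using d by simp
  ultimately have "matrix_sqrt G = S"
    unfolding matrix_sqrt_def
    by (intro the_equality conjI) (simp_all add: pos_def_sqrt_unique)
  with \<open>sym_pos_def S\<close> \<open>S ** S = G\<close>
  show "sym_pos_def (matrix_sqrt G)" "matrix_sqrt G ** matrix_sqrt G = G" by simp_all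
qed

lemma gnorm_eq_norm_sqrt:
  assumes "sym_pos_def G"
  shows "gnorm G v = norm (matrix_sqrt G *v v)"
proof -
  let ?S = "matrix_sqrt G"
  have S: "transpose ?S = ?S" "?S ** ?S = G"
    using matrix_sqrt_correct[OF assms] unfolding sym_pos_def_def by blast+
  have "v \<bullet> (G *v v) = v \<bullet> (?S *v (?S *v v))" by (simp add: matrix_vector_mul_assoc S(2))
  also have "\<dots> = (?S *v v) \<bullet> (?S *v v)" using S(1) by (rule inner_symmetric_matrix)
  finally show ?thesis by (simp add: gnorm_def norm_eq_sqrt_inner)
qed

section \<open>Low-rank approximation and eigenvalue tails\<close>

text \<open>
  Both sides are polynomials in \<open>x\<close> that agree everywhere, hence have the same roots with the same
  multiplicities.
\<close>
lemma mset_eq_if_prod_linear_eq: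
  fixes a :: "'i \<Rightarrow> real" and b :: "'j \<Rightarrow> real"
  assumes "finite I" "finite J" "\<And>x. (\<Prod>i\<in>I. x - a i) = (\<Prod>j\<in>J. x - b j)"
  shows "image_mset a (mset_set I) = image_mset b (mset_set J)"
proof -
  have roots: "proots (\<Prod>i\<in>K. [:- c i, 1:]) = image_mset c (mset_set K)" if "finite K"
    for c :: "'k \<Rightarrow> real" and K
    using that
  proof induction
    case (insert k K)
    then have "proots ([:- c k, 1:] * (\<Prod>i\<in>K. [:- c i, 1:])) =
        proots [:- c k, 1:] + proots (\<Prod>i\<in>K. [:- c i, 1:])"
      by (intro proots_mult) (auto simp: prod_zero_iff)
    with insert show ?case by simp
  qed simp
  have "poly (\<Prod>i\<in>I. [:- a i, 1:]) = poly (\<Prod>j\<in>J. [:- b j, 1:])"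
    using assms(3) by (auto simp: poly_prod fun_eq_iff)
  then have "(\<Prod>i\<in>I. [:- a i, 1:]) = (\<Prod>j\<in>J. [:- b j, 1:])"
    by (simp add: poly_eq_poly_eq_iff)
  then show ?thesis using roots assms(1,2) by metis
qed

lemma matrix_add_rdistrib:
  fixes A B :: "real^'n^'m"
  shows "(A + B) ** C = A ** C + B ** C"
  by (simp add: vec_eq_iff matrix_matrix_mult_def distrib_right sum.distrib)

text \<open>
  Links the two descriptions of the spectrum: the roots of the characteristic polynomial, listed by
  \<open>eigval\<close>, and the diagonal entries of a diagonalization, which come in no particular order. Only symmetric
  functions of the eigenvalues are ever compared, so no explicit reordering is needed.
\<close>
lemma sum_eigenvalues_desc:
  fixes C Q :: "real^'n^'n"
  assumes eig: "eigenvalues_desc C eigval"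
    and Q: "transpose Q ** Q = mat 1" "Q ** transpose Q = mat 1"
    and C: "C = Q ** diagonal d ** transpose Q"
  shows "(\<Sum>i\<in>UNIV. f (d i)) = (\<Sum>k = 1..CARD('n). f (eigval k))"
proof -
  have "det (mat x - C) = (\<Prod>i\<in>UNIV. x - d i)" for x
  proof -
    have "Q ** mat x = x *\<^sub>R Q"
      by (simp add: vec_eq_iff matrix_matrix_mult_def mat_def if_distrib[of "\<lambda>y. _ * y"] mult.commute
          cong: if_cong)
    moreover have "(x *\<^sub>R Q) ** transpose Q = x *\<^sub>R (Q ** transpose Q)"
      by (simp add: vec_eq_iff matrix_matrix_mult_def sum_distrib_left mult.assoc)
    moreover have "x *\<^sub>R mat 1 = (mat x :: real^'n^'n)"
      by (simp add: vec_eq_iff mat_def)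
    ultimately have "mat x = Q ** mat x ** transpose Q" using Q(2) by simp
    then have "mat x = Q ** (mat x - diagonal d) ** transpose Q + C"
      using matrix_add_ldistrib[of Q "mat x - diagonal d" "diagonal d"]
        matrix_add_rdistrib[of "Q ** (mat x - diagonal d)" "Q ** diagonal d" "transpose Q"]
      by (simp add: C)
    then have "mat x - C = Q ** (mat x - diagonal d) ** transpose Q"
      unfolding diff_eq_eq .
    then have "det (mat x - C) = det Q * det (transpose Q) * det (mat x - diagonal d)"
      by (simp add: det_mul)
    also have "det Q * det (transpose Q) = 1"
      using Q(2) by (metis det_I det_mul)
    also have "det (mat x - diagonal d) = (\<Prod>i\<in>UNIV. (mat x - diagonal d) $ i $ i)"
      by (intro det_diagonal) (simp add: mat_def diagonal_def)
    finally show ?thesis by (simp add: mat_def diagonal_def)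
  qed
  then have "image_mset d (mset_set UNIV) = image_mset eigval (mset_set {1..CARD('n)})"
    using eig by (intro mset_eq_if_prod_linear_eq) (auto simp: eigenvalues_desc_def)
  then have "image_mset f (image_mset d (mset_set UNIV))
      = image_mset f (image_mset eigval (mset_set {1..CARD('n)}))"
    by simp
  then have "image_mset (\<lambda>i. f (d i)) (mset_set UNIV) = image_mset (\<lambda>k. f (eigval k)) (mset_set {1..CARD('n)})"
    by (simp only: multiset.map_comp comp_def)
  then show ?thesis by (simp add: sum_unfold_sum_mset)
qed

text \<open>
  Completing the square in the coefficients. Taking the coefficients \<open>e \<bullet> w\<close> yields Bessel's
  inequality; dropping the last sum bounds the distance to the span from below.
\<close>
lemma dist_orthonormal_combination:
  assumes B: "finite B" "pairwise orthogonal B" "\<And>e. e \<in> B \<Longrightarrow> norm e = 1"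
  shows "(norm (w - (\<Sum>e\<in>B. c e *\<^sub>R e)))\<^sup>2
    = (norm w)\<^sup>2 - (\<Sum>e\<in>B. (e \<bullet> w)\<^sup>2) + (\<Sum>e\<in>B. (c e - e \<bullet> w)\<^sup>2)"
proof -
  define z where "z = (\<Sum>e\<in>B. c e *\<^sub>R e)"
  have ez: "e \<bullet> z = c e" if "e \<in> B" for e
  proof -
    have "e \<bullet> z = (\<Sum>f\<in>B. if f = e then c f else 0)"
      unfolding z_def inner_sum_right using B(2,3) that
      by (intro sum.cong) (auto simp: pairwise_def orthogonal_def dot_square_norm)
    then show ?thesis using B(1) that by simp
  qed
  have "z \<bullet> z = (\<Sum>e\<in>B. (c e)\<^sup>2)"
    by (subst z_def) (simp add: inner_sum_left ez power2_eq_square)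
  moreover have "z \<bullet> w = (\<Sum>e\<in>B. c e * (e \<bullet> w))"
    by (simp add: z_def inner_sum_left)
  moreover have "(norm (w - z))\<^sup>2 = (norm w)\<^sup>2 - 2 * (z \<bullet> w) + z \<bullet> z"
    by (simp add: power2_norm_eq_inner inner_diff_left inner_diff_right inner_commute)
  ultimately show ?thesis
    by (simp add: power2_diff sum.distrib sum_subtractf sum_distrib_left mult.assoc flip: z_def)
qed

lemma dist_span_orthonormal:
  assumes B: "finite B" "pairwise orthogonal B" "\<And>e. e \<in> B \<Longrightarrow> norm e = 1" and z: "z \<in> span B"
  shows "(norm w)\<^sup>2 - (\<Sum>e\<in>B. (e \<bullet> w)\<^sup>2) \<le> (norm (w - z))\<^sup>2"
proof -
  obtain c where "z = (\<Sum>e\<in>B. c e *\<^sub>R e)" using z B(1) by (auto simp: span_finite)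
  then show ?thesis
    using dist_orthonormal_combination[OF B, of w c] by (simp add: sum_nonneg)
qed

lemma bessel_inequality:
  assumes "finite B" "pairwise orthogonal B" "\<And>e. e \<in> B \<Longrightarrow> norm e = 1"
  shows "(\<Sum>e\<in>B. (e \<bullet> w)\<^sup>2) \<le> (norm w)\<^sup>2"
  using dist_orthonormal_combination[OF assms, of w "\<lambda>e. e \<bullet> w"]
    zero_le_power2[of "norm (w - (\<Sum>e\<in>B. (e \<bullet> w) *\<^sub>R e))"] by simp

text \<open>
  Ky Fan's maximum principle, in terms of what a compression to at most \<open>N\<close> dimensions leaves of the
  trace. In an eigenbasis the compressed trace is \<open>\<Sum>i. d i * p i\<close> with weights \<open>p i \<in> [0, 1]\<close> of total
  mass \<open>card B \<le> N\<close>. Comparing every \<open>d i\<close> with the threshold \<open>eigval N\<close> shows that such a sum is at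
  most the sum of the \<open>N\<close> largest eigenvalues.
\<close>
lemma eigenvalue_tail_le:
  fixes C :: "real^'n^'n"
  assumes sym: "transpose C = C" and eig: "eigenvalues_desc C eigval"
    and N: "1 \<le> N" "N \<le> CARD('n)" "0 \<le> eigval N"
    and B: "finite B" "pairwise orthogonal B" "\<And>e. e \<in> B \<Longrightarrow> norm e = 1" "card B \<le> N"
  shows "(\<Sum>k = N+1..CARD('n). eigval k) \<le> trace C - (\<Sum>e\<in>B. e \<bullet> (C *v e))"
proof -
  obtain Q :: "real^'n^'n" and d where Q: "transpose Q ** Q = mat 1" "Q ** transpose Q = mat 1"
    and C: "C = Q ** diagonal d ** transpose Q"
    using symmetric_diagonalizable[OF sym] by metis
  note sum_eig = sum_eigenvalues_desc[OF eig Q C]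
  \<comment> \<open>the squared length of the projection of the \<open>i\<close>-th eigenvector onto the span of \<open>B\<close>\<close>
  define p where "p i = (\<Sum>e\<in>B. (e \<bullet> (Q *v axis i 1))\<^sup>2)" for i
  have coord: "(transpose Q *v e) $ i = e \<bullet> (Q *v axis i 1)" for e i
    by (simp add: inner_matrix_mult_right inner_axis)
  have p: "0 \<le> p i" "p i \<le> 1" for i
  proof -
    show "0 \<le> p i" by (simp add: p_def sum_nonneg)
    show "p i \<le> 1"
      unfolding p_def using bessel_inequality[OF B(1-3), of "Q *v axis i 1"]
      by (simp add: norm_orthonormal_columns[OF Q(1)])
  qed
  have sum_p: "(\<Sum>i\<in>UNIV. p i) = card B"
  proof -
    have "(\<Sum>i\<in>UNIV. p i) = (\<Sum>e\<in>B. \<Sum>i\<in>UNIV. ((transpose Q *v e) $ i)\<^sup>2)"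
      unfolding p_def coord by (rule sum.swap)
    also have "\<dots> = (\<Sum>e\<in>B. (norm (transpose Q *v e))\<^sup>2)"
      by (simp add: power2_norm_eq_inner inner_vec_def flip: power2_eq_square)
    also have "\<dots> = (\<Sum>e\<in>B. 1)"
      using B(3) Q(2) by (simp add: norm_orthonormal_columns)
    finally show ?thesis by simp
  qed
  have "(\<Sum>e\<in>B. e \<bullet> (C *v e)) = (\<Sum>e\<in>B. \<Sum>i\<in>UNIV. d i * (e \<bullet> (Q *v axis i 1))\<^sup>2)"
    by (simp add: quadratic_form_diagonalized[OF C] coord)
  also have "\<dots> = (\<Sum>i\<in>UNIV. d i * p i)"
    by (subst sum.swap) (simp add: p_def sum_distrib_left)
  also have "\<dots> = (\<Sum>i\<in>UNIV. (d i - eigval N) * p i) + eigval N * (\<Sum>i\<in>UNIV. p i)"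
    by (simp add: sum_distrib_left algebra_simps flip: sum.distrib)
  also have "\<dots> \<le> (\<Sum>i\<in>UNIV. max 0 (d i - eigval N)) + eigval N * N"
  proof (intro add_mono sum_mono mult_left_mono)
    fix i
    have "(d i - eigval N) * p i \<le> max 0 (d i - eigval N) * p i" using p(1) by (intro mult_right_mono) auto
    also have "\<dots> \<le> max 0 (d i - eigval N)" using p by (simp add: mult_left_le)
    finally show "(d i - eigval N) * p i \<le> max 0 (d i - eigval N)" .
  qed (use N B(4) sum_p in auto)
  also have "(\<Sum>i\<in>UNIV. max 0 (d i - eigval N)) = (\<Sum>k = 1..CARD('n). max 0 (eigval k - eigval N))"
    by (rule sum_eig)
  also have "\<dots> = (\<Sum>k = 1..N. max 0 (eigval k - eigval N)) + (\<Sum>k = N+1..CARD('n). max 0 (eigval k - eigval N))"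
    using N sum.ub_add_nat[of 1 N "\<lambda>k. max 0 (eigval k - eigval N)" "CARD('n) - N"] by simp
  also have "(\<Sum>k = N+1..CARD('n). max 0 (eigval k - eigval N)) = 0"
    using eig N by (intro sum.neutral) (auto simp: eigenvalues_desc_def monotone_on_def)
  also have "(\<Sum>k = 1..N. max 0 (eigval k - eigval N)) = (\<Sum>k = 1..N. eigval k - eigval N)"
    using eig N by (intro sum.cong) (auto simp: eigenvalues_desc_def monotone_on_def)
  also have "\<dots> + 0 + eigval N * N = (\<Sum>k = 1..N. eigval k)"
    by (simp add: sum_subtractf)
  finally have le: "(\<Sum>e\<in>B. e \<bullet> (C *v e)) \<le> (\<Sum>k = 1..N. eigval k)" .
  have "trace C = trace (transpose Q ** (Q ** diagonal d))"
    using trace_mul_sym[of "Q ** diagonal d" "transpose Q"] by (simp add: C)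
  also have "\<dots> = trace (diagonal d)" using Q(1) by (simp add: matrix_mul_assoc)
  also have "\<dots> = (\<Sum>k = 1..CARD('n). eigval k)"
    using sum_eig[of "\<lambda>x. x"] by (simp add: trace_def diagonal_def)
  also have "\<dots> = (\<Sum>k = 1..N. eigval k) + (\<Sum>k = N+1..CARD('n). eigval k)"
    using N sum.ub_add_nat[of 1 N eigval "CARD('n) - N"] by simp
  finally show ?thesis using le by simp
qed

section \<open>Regularity of network realizations\<close>

text \<open>
  Continuity of a map into the vectors of all sizes is meant componentwise, at a fixed output size.
\<close>
definition vec_continuous :: "nat \<Rightarrow> ('x::topological_space \<Rightarrow> real Matrix.vec) \<Rightarrow> bool" where
  "vec_continuous n f \<longleftrightarrow>
     (\<forall>x. dim_vec (f x) = n) \<and> (\<forall>i<n. continuous_on UNIV (\<lambda>x. vec_index (f x) i))"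

lemma vec_continuous_append:
  assumes "vec_continuous n f" "vec_continuous m g"
  shows "vec_continuous (n + m) (\<lambda>x. f x @\<^sub>v g x)"
  unfolding vec_continuous_def
proof (intro conjI allI impI)
  fix i assume "i < n + m"
  then show "continuous_on UNIV (\<lambda>x. vec_index (f x @\<^sub>v g x) i)"
    using assms by (cases "i < n") (auto simp: vec_continuous_def)
qed (use assms in \<open>auto simp: vec_continuous_def\<close>)

lemma vec_continuous_affine:
  assumes "vec_continuous n f" "dim_row A = dim_vec b"
  shows "vec_continuous (dim_vec b) (\<lambda>x. A *\<^sub>v f x + b)"
  using assms
  by (auto simp: vec_continuous_def scalar_prod_def intro!: continuous_intros)

lemma vec_continuous_relu:
  assumes "vec_continuous n f"
  shows "vec_continuous n (\<lambda>x. relu (f x))"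
  using assms by (auto simp: vec_continuous_def relu_def intro!: continuous_intros)

text \<open>
  Induction over the layers, with the concatenation of the input and all earlier layers as the new input.
\<close>
lemma vec_continuous_realization:
  assumes "\<forall>(A, b)\<in>set net. dim_row A = dim_vec b" "net \<noteq> []" "vec_continuous n f"
  shows "vec_continuous (dim_vec (snd (last net))) (\<lambda>x. realization net (f x))"
  using assms(2,1,3)
proof (induction net arbitrary: n f rule: list_nonempty_induct)
  case (single L)
  then show ?case by (cases L) (auto intro: vec_continuous_affine)
next
  case (cons L Ls)
  obtain A b where L: "L = (A, b)" by (cases L)
  obtain L' Ls' where Ls: "Ls = L' # Ls'" using cons by (cases Ls) auto
  have "vec_continuous (n + dim_vec b) (\<lambda>x. f x @\<^sub>v relu (A *\<^sub>v f x + b))"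
    using cons.prems L
    by (intro vec_continuous_append vec_continuous_relu vec_continuous_affine[where n = n]) auto
  from cons.IH[OF _ this] cons.prems show ?case by (simp add: L Ls)
qed

lemma vec_continuous_network:
  assumes "arch_io \<Phi> d e" "vec_continuous n f"
  shows "vec_continuous e (\<lambda>x. realization (network_of \<Phi> \<theta>) (f x))"
proof -
  have "vec_continuous (dim_vec (snd (last (network_of \<Phi> \<theta>)))) (\<lambda>x. realization (network_of \<Phi> \<theta>) (f x))"
    using assms
    by (intro vec_continuous_realization[where n = n]) (auto simp: network_of_def arch_io_def)
  moreover have "dim_vec (snd (last (network_of \<Phi> \<theta>))) = e"
    using assms(1) by (auto simp: network_of_def arch_io_def last_map last_conv_nth)
  ultimately show ?thesis by simp
qed

lemma vec_continuous_to_coords: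
  "continuous_on UNIV f \<Longrightarrow> vec_continuous CARD('k) (\<lambda>x. to_coords (f x :: real^'k))"
  by (auto simp: vec_continuous_def to_coords_def intro!: continuous_intros)

lemma vec_continuous_singleton:
  "continuous_on UNIV f \<Longrightarrow> vec_continuous 1 (\<lambda>x. vec_of_list [f x])"
  by (auto simp: vec_continuous_def)

lemma to_nat_on_less_card: "to_nat_on UNIV (i :: 'k::finite) < CARD('k)"
  using to_nat_on_finite[of "UNIV :: 'k set"] by (auto dest: bij_betwE)

lemma continuous_on_of_coords:
  "vec_continuous CARD('k) f \<Longrightarrow> continuous_on UNIV (\<lambda>x. of_coords (f x) :: real^'k)"
  by (auto simp: vec_continuous_def of_coords_def to_nat_on_less_card intro!: continuous_intros)

text \<open>
  Serves the parallelization of the root networks, whose outputs are juxtaposed.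
\<close>
lemma vec_continuous_concat:
  assumes "\<And>i. i \<in> set is \<Longrightarrow> vec_continuous m (f i)"
  shows "vec_continuous (length is * m)
    (\<lambda>x. vec_of_list (concat (map (\<lambda>i. list_of_vec (f i x)) is)))"
  using assms
proof (induction "is")
  case Nil
  then show ?case by (simp add: vec_continuous_def)
next
  case (Cons j js)
  have "vec_of_list (list_of_vec v @ ys) = v @\<^sub>v vec_of_list ys" for v :: "real Matrix.vec" and ys
    by (metis list_of_vec_append list_vec vec_list)
  moreover have "vec_continuous (m + length js * m)
      (\<lambda>x. f j x @\<^sub>v vec_of_list (concat (map (\<lambda>i. list_of_vec (f i x)) js)))"
    using Cons by (intro vec_continuous_append) auto
  ultimately show ?case by simp
qed

lemma continuous_on_stack:
  assumes "vec_continuous (CARD('n) * CARD('a)) f"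
  shows "continuous_on UNIV (\<lambda>x. stack (f x) :: real^'n^'a)"
proof -
  have "to_nat_on UNIV c * CARD('a) + to_nat_on UNIV r < CARD('n) * CARD('a)" for c :: 'n and r :: 'a
  proof -
    have "to_nat_on UNIV c * CARD('a) + to_nat_on UNIV r < Suc (to_nat_on UNIV c) * CARD('a)"
      using to_nat_on_less_card[of r] by simp
    also have "\<dots> \<le> CARD('n) * CARD('a)"
      using to_nat_on_less_card[of c] by (intro mult_right_mono) auto
    finally show ?thesis .
  qed
  then show ?thesis
    using assms by (auto simp: vec_continuous_def stack_def intro!: continuous_intros)
qed

text \<open>
  The seed and root networks are continuous, but an orthonormalization such as Gram-Schmidt jumps at
  rank-deficient matrices; measurability is all that survives the composition.
\<close>
lemma measurable_dod_basis:
  fixes A :: "real^'a^'h" and orth :: "real^'n^'a \<Rightarrow> real^'n^'a"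
  assumes orth: "orthonormalization orth"
    and arch: "dod_arch_io \<Phi> CARD('p) CARD('a) CARD('n)"
  shows "(\<lambda>y :: (real^'p) \<times> real. dod_basis orth A \<Phi> \<theta> (fst y) (snd y)) \<in> borel_measurable borel"
proof -
  obtain l where l: "length (roots \<Phi>) = CARD('n)" "arch_io (seed \<Phi>) (CARD('p) + 1) l"
    "\<And>R. R \<in> set (roots \<Phi>) \<Longrightarrow> arch_io R l CARD('a)"
    using arch by (auto simp: dod_arch_io_def)
  have "vec_continuous (CARD('p) + 1) (\<lambda>y :: (real^'p) \<times> real. to_coords (fst y) @\<^sub>v vec_of_list [snd y])"
    by (intro vec_continuous_append vec_continuous_to_coords vec_continuous_singleton continuous_intros)
  from vec_continuous_network[OF l(2) this]
  have "vec_continuous (length [0..<length (roots \<Phi>)] * CARD('a))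
      (\<lambda>y :: (real^'p) \<times> real. dod_parallel \<Phi> \<theta> (to_coords (fst y) @\<^sub>v vec_of_list [snd y]))"
    unfolding dod_parallel_def Let_def
    by (intro vec_continuous_concat vec_continuous_network[OF l(3)]) auto
  then have "continuous_on UNIV
      (\<lambda>y :: (real^'p) \<times> real. stack (dod_parallel \<Phi> \<theta> (to_coords (fst y) @\<^sub>v vec_of_list [snd y])) :: real^'n^'a)"
    using l(1) by (intro continuous_on_stack) simp
  then have "(\<lambda>y :: (real^'p) \<times> real.
      stack (dod_parallel \<Phi> \<theta> (to_coords (fst y) @\<^sub>v vec_of_list [snd y])) :: real^'n^'a) \<in> borel_measurable borel"
    by (rule borel_measurable_continuous_onI)
  moreover have "orth \<in> borel_measurable borel" using orth by (simp add: orthonormalization_def)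
  ultimately have "(\<lambda>y :: (real^'p) \<times> real. dod_inner orth \<Phi> \<theta> (fst y) (snd y)) \<in> borel_measurable borel"
    unfolding dod_inner_def by (rule measurable_compose)
  moreover have "(\<lambda>W. A ** W :: real^'n^'h) \<in> borel_measurable borel"
    unfolding matrix_matrix_mult_def
    by (intro borel_measurable_continuous_onI continuous_intros)
  ultimately show ?thesis unfolding dod_basis_def by (rule measurable_compose)
qed

lemma continuous_on_network:
  assumes "arch_io \<Phi> (CARD('p) + CARD('q) + 1) CARD('n)"
  shows "continuous_on UNIV (\<lambda>x :: (real^'p) \<times> (real^'q) \<times> real.
    of_coords (realization (network_of \<Phi> \<theta>)
      (to_coords (fst x) @\<^sub>v to_coords (fst (snd x)) @\<^sub>v vec_of_list [snd (snd x)])) :: real^'n)"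
proof -
  have "vec_continuous (CARD('p) + (CARD('q) + 1)) (\<lambda>x :: (real^'p) \<times> (real^'q) \<times> real.
      to_coords (fst x) @\<^sub>v to_coords (fst (snd x)) @\<^sub>v vec_of_list [snd (snd x)])"
    by (intro vec_continuous_append vec_continuous_to_coords vec_continuous_singleton continuous_intros)
  then show ?thesis
    by (intro continuous_on_of_coords vec_continuous_network[OF assms])
qed

text \<open>
  The inner module has orthonormal columns for all weights, hence the basis is bounded uniformly in the
  parameters although it need not be continuous in them.
\<close>
lemma norm_dod_basis_le:
  fixes A :: "real^'a^'h" and orth :: "real^'n^'a \<Rightarrow> real^'n^'a"
  assumes "orthonormalization orth"
  shows "norm (dod_basis orth A \<Phi> \<theta> \<mu> t *v y) \<le> onorm ((*v) A) * norm y"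
proof -
  have "norm (dod_basis orth A \<Phi> \<theta> \<mu> t *v y) = norm (A *v (dod_inner orth \<Phi> \<theta> \<mu> t *v y))"
    by (simp add: dod_basis_def matrix_vector_mul_assoc)
  also have "\<dots> \<le> onorm ((*v) A) * norm (dod_inner orth \<Phi> \<theta> \<mu> t *v y)"
    by (intro onorm matrix_vector_mul_bounded_linear)
  also have "norm (dod_inner orth \<Phi> \<theta> \<mu> t *v y) = norm y"
    using assms by (intro norm_orthonormal_columns) (simp add: orthonormalization_def dod_inner_def)
  finally show ?thesis .
qed

section \<open>The error on one fibre\<close>

lemma set_integral_sum:
  fixes f :: "'i \<Rightarrow> 'a \<Rightarrow> 'b::{banach, second_countable_topology}"
  assumes "\<And>i. i \<in> I \<Longrightarrow> set_integrable M A (f i)"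
  shows "set_integrable M A (\<lambda>x. \<Sum>i\<in>I. f i x)"
    and "(LINT x:A|M. (\<Sum>i\<in>I. f i x)) = (\<Sum>i\<in>I. LINT x:A|M. f i x)"
  using assms unfolding set_integrable_def set_lebesgue_integral_def
  by (simp_all add: scaleR_sum_right)

text \<open>
  The quadratic form of a correlation matrix is the mean square of a coordinate of the transformed
  snapshots; this converts statements about the matrix into statements about the family \<open>v\<close>.
\<close>
lemma quadratic_form_integral_gram:
  fixes v :: "real^'q \<Rightarrow> real^'h" and S :: "real^'h^'h"
  assumes K: "compact K" and v: "continuous_on K v" and S: "transpose S = S"
  shows "x \<bullet> ((S ** (\<chi> i j. LINT \<nu>:K|lborel. v \<nu> $ i * v \<nu> $ j) ** S) *v x)
    = (LINT \<nu>:K|lborel. (x \<bullet> (S *v v \<nu>))\<^sup>2)"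
proof -
  define y where "y = S *v x"
  have int: "set_integrable lborel K (\<lambda>\<nu>. v \<nu> $ i * v \<nu> $ j)" for i j
    unfolding set_integrable_def using K v
    by (intro borel_integrable_compact continuous_intros)
  let ?I = "\<chi> i j. LINT \<nu>:K|lborel. v \<nu> $ i * v \<nu> $ j"
  have "x \<bullet> ((S ** ?I ** S) *v x) = y \<bullet> (?I *v y)"
    using inner_symmetric_matrix[OF S, of x "?I *v y"]
    by (simp add: y_def matrix_vector_mul_assoc matrix_mul_assoc)
  also have "\<dots> = (\<Sum>i\<in>UNIV. \<Sum>j\<in>UNIV. LINT \<nu>:K|lborel. y $ i * y $ j * (v \<nu> $ i * v \<nu> $ j))"
    by (simp add: inner_vec_def matrix_vector_mult_def sum_distrib_left mult_ac)
  also have "\<dots> = (LINT \<nu>:K|lborel. (\<Sum>i\<in>UNIV. \<Sum>j\<in>UNIV. y $ i * y $ j * (v \<nu> $ i * v \<nu> $ j)))"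
    using int by (simp add: set_integral_sum del: set_integral_mult_right)
  also have "\<dots> = (LINT \<nu>:K|lborel. (y \<bullet> v \<nu>)\<^sup>2)"
    by (simp add: inner_vec_def power2_eq_square sum_product mult_ac)
  also have "\<dots> = (LINT \<nu>:K|lborel. (x \<bullet> (S *v v \<nu>))\<^sup>2)"
    using inner_symmetric_matrix[OF S] by (simp add: y_def)
  finally show ?thesis .
qed

text \<open>
  Whatever the coefficients \<open>q\<close>, the squared error at \<open>\<nu>\<close> is at least the squared distance of
  \<open>S v \<nu>\<close> to the range of \<open>S W\<close>. That distance is continuous in \<open>\<nu>\<close>, and its square integrates to
  the trace of the correlation matrix minus the trace of its compression to this range, to which Ky Fan's
  principle applies.
\<close>
lemma eigenvalue_tail_le_fiber_error:
  fixes v :: "real^'q \<Rightarrow> real^'h" and S :: "real^'h^'h" and W :: "real^'n^'h"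
  assumes K: "compact K" and v: "continuous_on K v" and S: "transpose S = S"
    and eig: "eigenvalues_desc (S ** (\<chi> i j. LINT \<nu>:K|lborel. v \<nu> $ i * v \<nu> $ j) ** S) (\<lambda>k. (s k)\<^sup>2)"
    and n: "CARD('n) \<le> CARD('h)"
  shows "ennreal (\<Sum>k = CARD('n) + 1..CARD('h). (s k)\<^sup>2)
    \<le> (\<integral>\<^sup>+\<nu>\<in>K. ennreal ((norm (S *v (v \<nu> - W *v q \<nu>)))\<^sup>2) \<partial>lborel)"
proof -
  define C where "C = S ** (\<chi> i j. LINT \<nu>:K|lborel. v \<nu> $ i * v \<nu> $ j) ** S"
  note form = quadratic_form_integral_gram[OF K v S, folded C_def]
  have sym: "transpose C = C"
    using S by (simp add: C_def matrix_transpose_mul matrix_mul_assoc)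
      (simp add: transpose_def mult.commute)
  let ?R = "range ((*v) (S ** W))"
  have lin: "linear ((*v) (S ** W))" by (rule matrix_vector_mul_linear)
  then have "subspace ?R" by (simp add: linear_subspace_image)
  then obtain B where B: "pairwise orthogonal B" "\<And>e. e \<in> B \<Longrightarrow> norm e = 1" "independent B"
    "card B = dim ?R" "span B = ?R"
    by (rule orthonormal_basis_subspace) blast
  have finB: "finite B" using B(3) by (rule independent_imp_finite)
  have "card B \<le> CARD('n)"
    unfolding B(4) using dim_image_le[OF lin, of UNIV] by simp
  with sym eig n finB B(1,2)
  have tail: "(\<Sum>k = CARD('n) + 1..CARD('h). (s k)\<^sup>2) \<le> trace C - (\<Sum>e\<in>B. e \<bullet> (C *v e))"
    unfolding C_def[symmetric] by (intro eigenvalue_tail_le) auto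
  define \<psi> where "\<psi> \<nu> = (norm (S *v v \<nu>))\<^sup>2 - (\<Sum>e\<in>B. (e \<bullet> (S *v v \<nu>))\<^sup>2)" for \<nu>
  have cont: "continuous_on K (\<lambda>\<nu>. S *v v \<nu>)"
    unfolding matrix_vector_mult_def using v by (intro continuous_intros)
  have int: "set_integrable lborel K (\<lambda>\<nu>. (e \<bullet> (S *v v \<nu>))\<^sup>2)" for e
    unfolding set_integrable_def using K cont by (intro borel_integrable_compact continuous_intros)
  have "trace C = (\<Sum>i\<in>UNIV. axis i 1 \<bullet> (C *v axis i 1))"
    by (simp add: trace_def inner_axis' matrix_vector_mult_basis column_def)
  also have "\<dots> = (LINT \<nu>:K|lborel. (norm (S *v v \<nu>))\<^sup>2)"
    unfolding form set_integral_sum(2)[OF int, symmetric]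
    by (simp add: inner_axis' power2_norm_eq_inner[of "S *v v _"] inner_vec_def[of "S *v v _"]
        flip: power2_eq_square)
  finally have tr: "trace C = (LINT \<nu>:K|lborel. (norm (S *v v \<nu>))\<^sup>2)" .
  have intn: "set_integrable lborel K (\<lambda>\<nu>. (norm (S *v v \<nu>))\<^sup>2)"
    unfolding set_integrable_def using K cont by (intro borel_integrable_compact continuous_intros)
  have int\<psi>: "set_integrable lborel K \<psi>"
    unfolding \<psi>_def using int intn by (intro set_integral_diff set_integral_sum(1) finB) auto
  have "(LINT \<nu>:K|lborel. \<psi> \<nu>) = trace C - (\<Sum>e\<in>B. e \<bullet> (C *v e))"
    unfolding \<psi>_def tr form using int intn finB
    by (simp add: set_integral_diff set_integral_sum)
  with tail have "ennreal (\<Sum>k = CARD('n) + 1..CARD('h). (s k)\<^sup>2) \<le> ennreal (LINT \<nu>:K|lborel. \<psi> \<nu>)"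
    by (simp add: ennreal_leI)
  also have "\<dots> = (\<integral>\<^sup>+\<nu>. ennreal (indicator K \<nu> *\<^sub>R \<psi> \<nu>) \<partial>lborel)"
  proof -
    have "0 \<le> \<psi> \<nu>" for \<nu>
      unfolding \<psi>_def using bessel_inequality[OF finB B(1,2), of "S *v v \<nu>"] by simp
    then show ?thesis
      using int\<psi> unfolding set_integrable_def set_lebesgue_integral_def
      by (intro nn_integral_eq_integral[symmetric]) auto
  qed
  also have "\<dots> \<le> (\<integral>\<^sup>+\<nu>\<in>K. ennreal ((norm (S *v (v \<nu> - W *v q \<nu>)))\<^sup>2) \<partial>lborel)"
  proof (intro nn_integral_mono)
    fix \<nu>
    have "(S ** W) *v q \<nu> \<in> span B" using B(5) by blast
    from dist_span_orthonormal[OF finB B(1,2) this, of "S *v v \<nu>"]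
    have "\<psi> \<nu> \<le> (norm (S *v (v \<nu> - W *v q \<nu>)))\<^sup>2"
      by (simp add: \<psi>_def matrix_vector_mult_diff_distrib matrix_vector_mul_assoc)
    then show "ennreal (indicator K \<nu> *\<^sub>R \<psi> \<nu>)
        \<le> ennreal ((norm (S *v (v \<nu> - W *v q \<nu>)))\<^sup>2) * indicator K \<nu>"
      by (simp add: indicator_def ennreal_leI)
  qed
  finally show ?thesis .
qed

text \<open>
  Cauchy-Schwarz on a set of measure at most \<open>1\<close>, by an argument that avoids integrating \<open>g\<^sup>2\<close>.
  With \<open>a\<close> the integral of \<open>g\<close>, integrate \<open>2 a g - a\<^sup>2 \<le> g\<^sup>2 \<le> H\<close> over \<open>S\<close>; since the measure of
  \<open>S\<close> is at most \<open>1\<close>, the left-hand side integrates to at least \<open>2 a\<^sup>2 - a\<^sup>2\<close>.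
\<close>
lemma square_set_integral_le_nn_integral:
  fixes g :: "'a \<Rightarrow> real"
  assumes S: "S \<in> sets N" "emeasure N S < \<infinity>" "measure N S \<le> 1"
    and g: "set_integrable N S g"
    and H: "\<And>y. y \<in> S \<Longrightarrow> ennreal ((g y)\<^sup>2) \<le> H y"
  shows "ennreal ((LINT y:S|N. g y)\<^sup>2) \<le> (\<integral>\<^sup>+y\<in>S. H y \<partial>N)"
proof -
  define a where "a = (LINT y:S|N. g y)"
  define \<phi> where "\<phi> y = indicator S y *\<^sub>R (2 * a * g y - a\<^sup>2)" for y
  have int: "set_integrable N S (\<lambda>y. 2 * a * g y)" "set_integrable N S (\<lambda>y. a\<^sup>2)"
    using g S by (auto intro: set_integrable_mult_right simp: set_integrable_def[of _ _ "\<lambda>_. a\<^sup>2"])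
  then have int\<phi>: "integrable N \<phi>"
    unfolding \<phi>_def using set_integral_diff(1)[OF int] by (simp add: set_integrable_def)
  have "integral\<^sup>L N \<phi> = (LINT y:S|N. 2 * a * g y) - (LINT y:S|N. a\<^sup>2)"
    unfolding \<phi>_def using set_integral_diff(2)[OF int] by (simp add: set_lebesgue_integral_def)
  also have "(LINT y:S|N. a\<^sup>2) = a\<^sup>2 * measure N S"
    using S by (simp add: set_lebesgue_integral_def mult.commute)
  also have "a\<^sup>2 \<le> (LINT y:S|N. 2 * a * g y) - a\<^sup>2 * measure N S"
    using mult_left_mono[OF S(3), of "a\<^sup>2"] by (simp add: a_def power2_eq_square)
  ultimately have "ennreal (a\<^sup>2) \<le> ennreal (integral\<^sup>L N \<phi>)" by (simp add: ennreal_leI)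
  also have "\<dots> \<le> (\<integral>\<^sup>+y. ennreal (max 0 (\<phi> y)) \<partial>N)"
  proof -
    have "integral\<^sup>L N \<phi> \<le> integral\<^sup>L N (\<lambda>y. max 0 (\<phi> y))"
      using int\<phi> by (intro integral_mono) auto
    also have "ennreal \<dots> = (\<integral>\<^sup>+y. ennreal (max 0 (\<phi> y)) \<partial>N)"
      using int\<phi> by (intro nn_integral_eq_integral[symmetric]) auto
    finally show ?thesis by (simp add: ennreal_leI)
  qed
  also have "\<dots> \<le> (\<integral>\<^sup>+y\<in>S. H y \<partial>N)"
  proof (intro nn_integral_mono)
    fix y
    have "2 * a * g y - a\<^sup>2 \<le> (g y)\<^sup>2"
      using zero_le_power2[of "g y - a"] by (simp add: power2_diff algebra_simps)
    then show "ennreal (max 0 (\<phi> y)) \<le> H y * indicator S y"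
      using H[of y] by (auto simp: \<phi>_def indicator_def intro: order_trans[OF ennreal_leI])
  qed
  finally show ?thesis by (simp add: a_def)
qed

section \<open>The relative error and integration over the parameter domain\<close>

text \<open>
  Tonelli's theorem with the middle variable integrated first: the fibre over \<open>(\<mu>, t)\<close> is the set of
  all \<open>\<nu>\<close>, which sits between them in the triple.
\<close>
lemma nn_integral_lborel_middle:
  fixes f :: "'a::euclidean_space \<times> 'b::euclidean_space \<times> 'c::euclidean_space \<Rightarrow> ennreal"
  assumes [measurable]: "f \<in> borel_measurable borel"
  shows "(\<integral>\<^sup>+x. f x \<partial>lborel) = (\<integral>\<^sup>+y. \<integral>\<^sup>+\<nu>. f (fst y, \<nu>, snd y) \<partial>lborel \<partial>lborel)"
proof -
  have [measurable]: "f \<in> borel_measurable (borel \<Otimes>\<^sub>M borel \<Otimes>\<^sub>M borel)"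
    using assms by (simp add: borel_prod)
  have "(\<integral>\<^sup>+x. f x \<partial>lborel) = (\<integral>\<^sup>+x. f x \<partial>(lborel \<Otimes>\<^sub>M lborel \<Otimes>\<^sub>M lborel))"
    by (simp add: lborel_prod)
  also have "\<dots> = (\<integral>\<^sup>+\<mu>. \<integral>\<^sup>+z. f (\<mu>, z) \<partial>(lborel \<Otimes>\<^sub>M lborel) \<partial>lborel)"
    by (subst sigma_finite_measure.nn_integral_fst) (auto simp: lborel_prod lborel.sigma_finite_measure_axioms)
  also have "\<dots> = (\<integral>\<^sup>+\<mu>. \<integral>\<^sup>+\<nu>. \<integral>\<^sup>+t. f (\<mu>, \<nu>, t) \<partial>lborel \<partial>lborel \<partial>lborel)"
    by (subst lborel.nn_integral_fst) auto
  also have "\<dots> = (\<integral>\<^sup>+\<mu>. \<integral>\<^sup>+t. \<integral>\<^sup>+\<nu>. f (\<mu>, \<nu>, t) \<partial>lborel \<partial>lborel \<partial>lborel)"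
    by (subst lborel_pair.Fubini') auto
  also have "\<dots> = (\<integral>\<^sup>+y. \<integral>\<^sup>+\<nu>. f (fst y, \<nu>, snd y) \<partial>lborel \<partial>(lborel \<Otimes>\<^sub>M lborel))"
    by (subst lborel.nn_integral_fst[symmetric]) auto
  finally show ?thesis by (simp add: lborel_prod)
qed

lemma gnorm_nonneg:
  assumes "sym_pos_def G"
  shows "0 \<le> gnorm G v"
  by (simp add: gnorm_eq_norm_sqrt[OF assms])

lemma continuous_on_gnorm: "continuous_on UNIV (gnorm G)"
  unfolding gnorm_def matrix_vector_mult_def by (intro continuous_intros)

lemma gnorm_bounded_if_bounded:
  assumes G: "sym_pos_def G" and X: "bounded X"
  obtains K where "\<And>x. x \<in> X \<Longrightarrow> gnorm G x \<le> K"
proof -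
  obtain r where r: "\<And>x. x \<in> X \<Longrightarrow> norm x \<le> r" using X by (auto simp: bounded_iff)
  have "gnorm G x \<le> onorm ((*v) (matrix_sqrt G)) * r" if "x \<in> X" for x
  proof -
    have "gnorm G x \<le> onorm ((*v) (matrix_sqrt G)) * norm x"
      unfolding gnorm_eq_norm_sqrt[OF G] by (intro onorm matrix_vector_mul_bounded_linear)
    also have "\<dots> \<le> onorm ((*v) (matrix_sqrt G)) * r"
      using r[OF that] by (intro mult_left_mono onorm_pos_le matrix_vector_mul_bounded_linear)
    finally show ?thesis .
  qed
  then show ?thesis by (rule that)
qed

text \<open>
  An essential supremum that is finite excludes both a null set \<open>D\<close>, on which it would be \<open>-\<infinity>\<close>, and a
  function that is not measurable, for which it is \<open>\<infinity>\<close> by convention. The former gives \<open>m \<le> M\<close>.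
\<close>
lemma AE_ess_bounds:
  assumes D: "D \<in> sets borel" and m: "ereal m = ess_inf_on D f" and M: "ereal M = ess_sup_on D f"
  shows "AE x in lborel. x \<in> D \<longrightarrow> m \<le> f x \<and> f x \<le> M"
    and "m \<le> M"
proof -
  let ?D = "restrict_space lborel D"
  have up: "AE x in ?D. f x \<le> M"
    using esssup_AE[of "\<lambda>x. ereal (f x)" ?D] by (simp add: M[unfolded ess_sup_on_def, symmetric])
  have "esssup ?D (\<lambda>x. - ereal (f x)) = ereal (- m)"
    using m by (metis ess_inf_on_def ereal_uminus_uminus uminus_ereal.simps(1))
  then have lo: "AE x in ?D. m \<le> f x"
    using esssup_AE[of "\<lambda>x. - ereal (f x)" ?D] by simp
  from up lo have both: "AE x in ?D. m \<le> f x \<and> f x \<le> M" by eventually_elim simp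
  then show "AE x in lborel. x \<in> D \<longrightarrow> m \<le> f x \<and> f x \<le> M"
    using D by (subst (asm) AE_restrict_space_iff) auto
  show "m \<le> M"
  proof (rule ccontr)
    assume "\<not> m \<le> M"
    then have "AE x in ?D. False"
      using both by (auto elim!: eventually_mono[rotated] simp del: eventually_const)
    then have null: "emeasure ?D (space ?D) = 0" by (simp add: AE_iff_measurable[OF _ refl])
    have "(\<lambda>x. ereal (f x)) \<in> borel_measurable ?D"
    proof (rule ccontr)
      assume "(\<lambda>x. ereal (f x)) \<notin> borel_measurable ?D"
      from esssup_non_measurable[OF this] show False
        using M by (simp add: ess_sup_on_def top_ereal_def)
    qed
    from esssup_zero_space[OF null this] show False using M by (simp add: ess_sup_on_def)
  qed
qed


text \<open>
  The bounds \<open>m\<close> and \<open>K\<close> make the integrand of the relative error bounded, hence integrable; without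
  integrability the relative error would be the default value \<open>0\<close>. The estimate is then pointwise, from
  the bound \<open>M\<close> for the norm in the denominator.
\<close>
lemma squared_error_le_relative_error:
  fixes u uhat :: "'x::euclidean_space \<Rightarrow> real^'h"
  assumes G: "sym_pos_def G" and D: "D \<in> sets borel" "emeasure lborel D < \<infinity>"
    and u: "(\<lambda>x. indicator D x *\<^sub>R u x) \<in> borel_measurable borel" and uhat: "uhat \<in> borel_measurable borel"
    and K: "\<And>x. x \<in> D \<Longrightarrow> gnorm G (u x - uhat x) \<le> K"
    and ae: "AE x in lborel. x \<in> D \<longrightarrow> m \<le> gnorm G (u x) \<and> gnorm G (u x) \<le> M" and m: "0 < m"
  shows "(\<integral>\<^sup>+x\<in>D. ennreal ((gnorm G (u x - uhat x))\<^sup>2) \<partial>lborel)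
    \<le> ennreal ((M * relative_error G D u uhat)\<^sup>2)"
proof -
  define r where "r x = indicator D x *\<^sub>R ((gnorm G (u x - uhat x))\<^sup>2 / (gnorm G (u x))\<^sup>2)" for x
  have r_nonneg: "0 \<le> r x" for x by (simp add: r_def)
  have [measurable]: "gnorm G \<in> borel_measurable borel"
    by (intro borel_measurable_continuous_onI continuous_on_gnorm)
  note [measurable] = u uhat D(1)
  have r_eq: "r = (\<lambda>x. indicator D x * ((gnorm G (indicator D x *\<^sub>R u x - uhat x))\<^sup>2
      / (gnorm G (indicator D x *\<^sub>R u x))\<^sup>2))"
    by (auto simp: r_def fun_eq_iff indicator_def)
  have meas: "r \<in> borel_measurable lborel"
    unfolding r_eq by measurable
  have "integrable lborel r"
  proof (rule integrableI_bounded_set[where A = D and B = "K\<^sup>2 / m\<^sup>2"])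
    show "AE x in lborel. x \<in> D \<longrightarrow> norm (r x) \<le> K\<^sup>2 / m\<^sup>2"
      using ae
    proof eventually_elim
      case (elim x)
      show ?case
      proof
        assume x: "x \<in> D"
        then have "(gnorm G (u x - uhat x))\<^sup>2 / (gnorm G (u x))\<^sup>2 \<le> K\<^sup>2 / m\<^sup>2"
          using elim K m gnorm_nonneg[OF G]
          by (intro frac_le power_mono) (auto simp: zero_less_power2)
        then show "norm (r x) \<le> K\<^sup>2 / m\<^sup>2" using x by (simp add: r_def)
      qed
    qed
  qed (use D meas in \<open>auto simp: r_def\<close>)
  then have int: "integrable lborel (\<lambda>x. M\<^sup>2 * r x)" by simp
  have "(\<integral>\<^sup>+x\<in>D. ennreal ((gnorm G (u x - uhat x))\<^sup>2) \<partial>lborel) \<le> (\<integral>\<^sup>+x. ennreal (M\<^sup>2 * r x) \<partial>lborel)"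
  proof (intro nn_integral_mono_AE)
    show "AE x in lborel. ennreal ((gnorm G (u x - uhat x))\<^sup>2) * indicator D x \<le> ennreal (M\<^sup>2 * r x)"
      using ae
    proof eventually_elim
      case (elim x)
      show ?case
      proof (cases "x \<in> D")
        case True
        with elim m have b: "0 < gnorm G (u x)" "gnorm G (u x) \<le> M" by auto
        then have "(gnorm G (u x))\<^sup>2 \<le> M\<^sup>2" by (intro power_mono) auto
        then have "(gnorm G (u x))\<^sup>2 * (gnorm G (u x - uhat x))\<^sup>2 \<le> M\<^sup>2 * (gnorm G (u x - uhat x))\<^sup>2"
          by (intro mult_right_mono) auto
        then have "(gnorm G (u x - uhat x))\<^sup>2 \<le> M\<^sup>2 * r x"
          using b True by (simp add: r_def field_simps)
        then show ?thesis using True by (simp add: ennreal_leI)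
      qed simp
    qed
  qed
  also have "\<dots> = ennreal (\<integral>x. M\<^sup>2 * r x \<partial>lborel)"
    using int r_nonneg by (intro nn_integral_eq_integral) auto
  also have "(\<integral>x. M\<^sup>2 * r x \<partial>lborel) = (M * relative_error G D u uhat)\<^sup>2"
  proof -
    have "0 \<le> integral\<^sup>L lborel r" using r_nonneg by (simp add: integral_nonneg_AE)
    moreover have "relative_error G D u uhat = sqrt (integral\<^sup>L lborel r)"
      by (simp add: relative_error_def set_lebesgue_integral_def r_def[abs_def])
    ultimately show ?thesis by (simp add: power_mult_distrib)
  qed
  finally show ?thesis .
qed

section \<open>The lower bound for the DOD+DNN error\<close>

theorem theorem4:
  fixes \<Theta> :: "(real^'p) set" and \<Theta>' :: "(real^'q) set" and T m M L \<epsilon> :: real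
    and G :: "real^'h^'h"
    and u :: "(real^'p) \<times> (real^'q) \<times> real \<Rightarrow> real^'h"
    and P :: "'w measure" and X :: "nat \<Rightarrow> 'w \<Rightarrow> real^'p" and Y :: "nat \<Rightarrow> 'w \<Rightarrow> real^'q"
    and \<omega> :: 'w and Ns1 Ns2 Nt :: nat
    and A :: "real^'a^'h"
    and orth :: "real^'n^'a \<Rightarrow> real^'n^'a"
    and \<Phi>V :: dod_arch and \<theta>DOD :: dod_weights
    and cA :: "real^'a^'h \<Rightarrow> ((real^'p) \<times> (real^'q) \<times> real) set \<Rightarrow> real"
    and \<Phi>D :: arch and \<theta>DDNN :: weights
    and V :: "real^'p \<Rightarrow> real \<Rightarrow> real^'n^'h"
    and qhat :: "real^'p \<Rightarrow> real^'q \<Rightarrow> real \<Rightarrow> real^'n"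
    and uhat :: "(real^'p) \<times> (real^'q) \<times> real \<Rightarrow> real^'h"
    and \<sigma> :: "real^'p \<Rightarrow> real \<Rightarrow> nat \<Rightarrow> real"
  assumes dims: "CARD('n) < CARD('a)" "CARD('a) \<le> CARD('h)"
    and domain: "compact \<Theta>" "compact \<Theta>'" "0 < T"
    and volume: "measure lborel (\<Theta> \<times> {0..T}) \<le> 1"
    and G: "sym_pos_def G"
    and m: "ereal m = ess_inf_on (param_dom \<Theta> \<Theta>' T) (\<lambda>x. gnorm G (u x))" "0 < m"
    and M: "ereal M = ess_sup_on (param_dom \<Theta> \<Theta>' T) (\<lambda>x. gnorm G (u x))"
    and lipschitz: "0 < L" "L-lipschitz_on (param_dom \<Theta> \<Theta>' T) u"
    and sampling: "training_samples P X Y Ns1 Ns2 \<Theta> \<Theta>'" "\<omega> \<in> space P"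
      "2 \<le> Ns1 * Ns2" "2 \<le> Nt"
    and pod: "pod_matrix G
        ((measure lborel (param_dom \<Theta> \<Theta>' T) / real (Ns1 * Ns2 * Nt)) *\<^sub>R
          (snapshot_gram u (\<lambda>i. X i \<omega>) (\<lambda>j. Y j \<omega>) Ns1 Ns2 Nt T ** G)) A"
    and orth: "orthonormalization orth"
    and dod_arch: "dod_arch_io \<Phi>V CARD('p) CARD('a) CARD('n)"
      "\<theta>DOD \<in> dod_weight_space \<Phi>V"
    and V: "V = dod_basis orth A \<Phi>V \<theta>DOD"
    and dod_bound: "0 < \<epsilon>" "0 < cA A (param_dom \<Theta> \<Theta>' T)"
      "dod_bound G \<Theta> \<Theta>' T u A V \<epsilon> (cA A (param_dom \<Theta> \<Theta>' T))"
    and ddnn_arch: "arch_io \<Phi>D (CARD('p) + CARD('q) + 1) CARD('n)"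
      "\<theta>DDNN \<in> weight_space \<Phi>D"
    and qhat: "\<And>\<mu> \<nu> t. qhat \<mu> \<nu> t = of_coords (realization (network_of \<Phi>D \<theta>DDNN)
        (to_coords \<mu> @\<^sub>v to_coords \<nu> @\<^sub>v vec_of_list [t]))"
    and uhat: "\<And>\<mu> \<nu> t. uhat (\<mu>, \<nu>, t) = V \<mu> t *v qhat \<mu> \<nu> t"
    and \<sigma>: "\<And>\<mu> t. \<mu> \<in> \<Theta> \<Longrightarrow> t \<in> {0..T} \<Longrightarrow>
        eigenvalues_desc (correlation_matrix G \<Theta>' u \<mu> t) (\<lambda>k. (\<sigma> \<mu> t k)\<^sup>2)"
  shows "relative_error G (param_dom \<Theta> \<Theta>' T) u uhat \<ge>
    m / M * (inverse m * (LINT y:\<Theta> \<times> {0..T}|lborel. (case y of (\<mu>, t) \<Rightarrow>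
      sqrt (\<Sum>k = CARD('n) + 1..CARD('h). (\<sigma> \<mu> t k)\<^sup>2))))"
proof -
  define D where "D = param_dom \<Theta> \<Theta>' T"
  define S where "S = \<Theta> \<times> {0..T}"
  define g where "g y = sqrt (\<Sum>k = CARD('n) + 1..CARD('h). (\<sigma> (fst y) (snd y) k)\<^sup>2)" for y
  have compact: "compact D" "compact S"
    using domain by (auto simp: D_def S_def intro: compact_Times)
  have cont_u: "continuous_on D u"
    using lipschitz(2) by (simp add: D_def lipschitz_on_continuous_on)
  define Q where "Q x = qhat (fst x) (fst (snd x)) (snd (snd x))" for x
  have cont_Q: "continuous_on UNIV Q"
    unfolding Q_def qhat by (rule continuous_on_network[OF ddnn_arch(1)])
  have uhat_eq: "uhat x = V (fst x) (snd (snd x)) *v Q x" for x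
    using uhat by (cases x) (simp add: Q_def)
  have "(\<lambda>x. V (fst x) (snd (snd x)) *v Q x) \<in> borel_measurable borel"
  proof (rule borel_measurable_continuous_Pair[where H = "(*v)"])
    have "(\<lambda>x :: (real^'p) \<times> (real^'q) \<times> real. (fst x, snd (snd x))) \<in> borel_measurable borel"
      by (intro borel_measurable_continuous_onI continuous_intros)
    from measurable_compose[OF this measurable_dod_basis[OF orth dod_arch(1), where A = A and \<theta> = \<theta>DOD]]
    show "(\<lambda>x :: (real^'p) \<times> (real^'q) \<times> real. V (fst x) (snd (snd x))) \<in> borel_measurable borel" by (simp add: V)
    show "Q \<in> borel_measurable borel" using cont_Q by (rule borel_measurable_continuous_onI)
    show "continuous_on UNIV (\<lambda>x :: (real^'n^'h) \<times> (real^'n). fst x *v snd x)"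
      unfolding matrix_vector_mult_def by (intro continuous_intros)
  qed
  then have meas_uhat: "uhat \<in> borel_measurable borel" by (simp flip: uhat_eq)
  have meas_u: "(\<lambda>x. indicator D x *\<^sub>R u x) \<in> borel_measurable borel"
    using compact(1) cont_u by (intro borel_measurable_continuous_on_indicator borel_compact)
  have "bounded ((\<lambda>x. u x - uhat x) ` D)"
  proof -
    have "bounded (u ` D)" "bounded (Q ` D)"
      using compact(1) cont_u continuous_on_subset[OF cont_Q]
      by (auto intro!: compact_imp_bounded compact_continuous_image)
    then obtain b c where bc: "\<And>x. x \<in> D \<Longrightarrow> norm (u x) \<le> b" "\<And>x. x \<in> D \<Longrightarrow> norm (Q x) \<le> c"
      unfolding bounded_iff by blast
    have "norm (u x - uhat x) \<le> b + onorm ((*v) A) * c" if "x \<in> D" for x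
    proof -
      have "norm (uhat x) \<le> onorm ((*v) A) * norm (Q x)"
        unfolding uhat_eq V by (rule norm_dod_basis_le[OF orth])
      also have "\<dots> \<le> onorm ((*v) A) * c"
        using bc(2)[OF that] by (intro mult_left_mono onorm_pos_le matrix_vector_mul_bounded_linear)
      finally show ?thesis using bc(1)[OF that] norm_triangle_ineq4[of "u x" "uhat x"] by linarith
    qed
    then show ?thesis unfolding bounded_iff by blast
  qed
  then obtain K where "\<And>z. z \<in> (\<lambda>x. u x - uhat x) ` D \<Longrightarrow> gnorm G z \<le> K"
    using gnorm_bounded_if_bounded[OF G] by blast
  then have K: "gnorm G (u x - uhat x) \<le> K" if "x \<in> D" for x using that by blast
  have D: "D \<in> sets borel" "emeasure lborel D < \<infinity>"
    using compact(1) emeasure_compact_finite[of D] by (auto intro: borel_compact)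
  have S: "S \<in> sets lborel" "emeasure lborel S < \<infinity>"
    using compact(2) emeasure_compact_finite[of S] by (auto intro: borel_compact)
  note ess = AE_ess_bounds[OF D(1) m(1)[folded D_def] M[folded D_def]]
  have "0 < M" using ess(2) m(2) by simp
  note err_le = squared_error_le_relative_error[OF G D meas_u meas_uhat K ess(1) m(2)]
  have err_nonneg: "0 \<le> relative_error G D u uhat"
    by (auto simp: relative_error_def set_lebesgue_integral_def intro!: integral_nonneg_AE)
  have "(LINT y:S|lborel. g y) \<le> M * relative_error G D u uhat"
  proof (cases "set_integrable lborel S g")
    case True
    define f where "f x = ennreal ((gnorm G (u x - uhat x))\<^sup>2) * indicator D x" for x
    have fiber: "ennreal ((g y)\<^sup>2) \<le> (\<integral>\<^sup>+\<nu>. f (fst y, \<nu>, snd y) \<partial>lborel)" if "y \<in> S" for y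
    proof -
      obtain \<mu> t where y: "y = (\<mu>, t)" "\<mu> \<in> \<Theta>" "t \<in> {0..T}" using \<open>y \<in> S\<close> by (auto simp: S_def)
      have "continuous_on \<Theta>' (\<lambda>\<nu>. u (\<mu>, \<nu>, t))"
        using y by (intro continuous_on_compose2[OF cont_u] continuous_intros) (auto simp: D_def)
      note tail = eigenvalue_tail_le_fiber_error[OF domain(2) this _
          \<sigma>[OF y(2,3), unfolded correlation_matrix_def], where W = "V \<mu> t" and q = "\<lambda>\<nu>. qhat \<mu> \<nu> t"]
      have "ennreal (\<Sum>k = CARD('n) + 1..CARD('h). (\<sigma> \<mu> t k)\<^sup>2)
          \<le> (\<integral>\<^sup>+\<nu>\<in>\<Theta>'. ennreal ((norm (matrix_sqrt G *v (u (\<mu>, \<nu>, t) - V \<mu> t *v qhat \<mu> \<nu> t)))\<^sup>2) \<partial>lborel)"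
        using matrix_sqrt_correct(1)[OF G] dims by (intro tail) (auto simp: sym_pos_def_def)
      also have "\<dots> = (\<integral>\<^sup>+\<nu>. f (fst y, \<nu>, snd y) \<partial>lborel)"
        using y by (intro nn_integral_cong)
          (auto simp: f_def D_def uhat gnorm_eq_norm_sqrt[OF G] indicator_def)
      finally show ?thesis using y by (simp add: g_def sum_nonneg)
    qed
    have meas_f: "f \<in> borel_measurable borel"
    proof -
      have [measurable]: "gnorm G \<in> borel_measurable borel"
        by (intro borel_measurable_continuous_onI continuous_on_gnorm)
      note [measurable] = meas_u meas_uhat D(1)
      have "f = (\<lambda>x. ennreal ((gnorm G (indicator D x *\<^sub>R u x - uhat x))\<^sup>2) * indicator D x)"
        by (auto simp: f_def fun_eq_iff indicator_def)
      then show ?thesis by simp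
    qed
    have "ennreal ((LINT y:S|lborel. g y)\<^sup>2) \<le> (\<integral>\<^sup>+y\<in>S. (\<integral>\<^sup>+\<nu>. f (fst y, \<nu>, snd y) \<partial>lborel) \<partial>lborel)"
      using S volume True fiber by (intro square_set_integral_le_nn_integral) (auto simp: S_def)
    also have "\<dots> \<le> (\<integral>\<^sup>+y. \<integral>\<^sup>+\<nu>. f (fst y, \<nu>, snd y) \<partial>lborel \<partial>lborel)"
      by (intro nn_integral_mono) (auto simp: indicator_def)
    also have "\<dots> = (\<integral>\<^sup>+x. f x \<partial>lborel)"
      by (rule nn_integral_lborel_middle[OF meas_f, symmetric])
    also have "\<dots> \<le> ennreal ((M * relative_error G D u uhat)\<^sup>2)"
      unfolding f_def by (rule err_le)
    finally have "(LINT y:S|lborel. g y)\<^sup>2 \<le> (M * relative_error G D u uhat)\<^sup>2" by simp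
    then show ?thesis by (rule power2_le_imp_le) (use \<open>0 < M\<close> err_nonneg in simp)
  next
    case False
    \<comment> \<open>the default value of the integral\<close>
    then have "(LINT y:S|lborel. g y) = 0"
      by (simp add: set_lebesgue_integral_def set_integrable_def not_integrable_integral_eq)
    then show ?thesis using \<open>0 < M\<close> err_nonneg by simp
  qed
  then have "(LINT y:S|lborel. g y) / M \<le> relative_error G D u uhat"
    using \<open>0 < M\<close> by (simp add: divide_le_eq mult.commute)
  moreover have "m / M * (inverse m * (LINT y:S|lborel. g y)) = (LINT y:S|lborel. g y) / M"
    using m(2) by simp
  ultimately have "m / M * (inverse m * (LINT y:S|lborel. g y)) \<le> relative_error G D u uhat"
    by (simp only:)
  then show ?thesis
    by (simp only: D_def S_def g_def case_prod_beta)
qed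

end
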